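(* Let $\Gamma$ be an almost bipartite $Q$-polynomial distance-regular graph with diameter $D\ge 3$, valency $k\ge 3$, and girth $6$. Then $\Gamma$ is the Odd graph on a set of cardinality $2D+1$.
   Context: Graphs are finite, undirected, connected, simple. A distance-regular graph has intersection numbers $p^h_{ij}=|\Gamma_i(x)\cap\Gamma_j(y)|$ for $\partial(x,y)=h$, independent of $x,y$; set $a_i=p^i_{1i}$. $\Gamma$ is almost bipartite if $a_i=0$ for $0\le i\le D-1$ and $a_D\ne 0$. $Q$-polynomial: there is an ordering $E_0,\dots,E_D$ of the primitive idempotents of the Bose–Mesner algebra, with $E_0=|X|^{-1}J$, such that the Krein parameters defined by $E_i\circ E_j=|X|^{-1}\sum_h q^h_{ij}E_h$ satisfy, for distinct $i,j$, $q^1_{ij}\ne0$ iff $|i-j|=1$. The Odd graph on a $(2D+1)$-set has as vertices the $D$-subsets, two being adjacent when disjoint. *)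

theory Defs
  imports "HOL-Analysis.Analysis" "HOL-Library.Extended_Nat"
begin

text \<open>
  A graph is given by its adjacency relation; its vertex set is the universe of a type of
  class \<open>finite\<close>, so that matrices indexed by the vertices are those of HOL-Analysis.
\<close>

definition connected_simple_graph :: "('v::finite \<Rightarrow> 'v \<Rightarrow> bool) \<Rightarrow> bool" where
  "connected_simple_graph adj \<longleftrightarrow> symp adj \<and> irreflp adj \<and> (\<forall>x y. adj\<^sup>*\<^sup>* x y)"

text \<open>Path-length distance: \<open>adj ^^ n\<close> relates the endpoints of walks of length \<open>n\<close>.\<close>

definition gdist :: "('v::finite \<Rightarrow> 'v \<Rightarrow> bool) \<Rightarrow> 'v \<Rightarrow> 'v \<Rightarrow> nat" where
  "gdist adj x y = (LEAST n. (adj ^^ n) x y)"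

definition diam :: "('v::finite \<Rightarrow> 'v \<Rightarrow> bool) \<Rightarrow> nat" where
  "diam adj = Max {gdist adj x y | x y. True}"

definition has_valency :: "('v::finite \<Rightarrow> 'v \<Rightarrow> bool) \<Rightarrow> nat \<Rightarrow> bool" where
  "has_valency adj k \<longleftrightarrow> (\<forall>x. card {y. adj x y} = k)"

definition is_cycle :: "('v::finite \<Rightarrow> 'v \<Rightarrow> bool) \<Rightarrow> 'v list \<Rightarrow> bool" where
  "is_cycle adj xs \<longleftrightarrow>
     length xs \<ge> 3 \<and> distinct xs \<and> successively adj xs \<and> adj (last xs) (hd xs)"

text \<open>The infimum of the empty set is \<open>\<infinity>\<close>, the girth of an acyclic graph.\<close>

definition girth :: "('v::finite \<Rightarrow> 'v \<Rightarrow> bool) \<Rightarrow> enat" where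
  "girth adj = Inf {enat (length xs) | xs. is_cycle adj xs}"

definition sphere_meet :: "('v::finite \<Rightarrow> 'v \<Rightarrow> bool) \<Rightarrow> nat \<Rightarrow> nat \<Rightarrow> 'v \<Rightarrow> 'v \<Rightarrow> 'v set" where
  "sphere_meet adj i j x y = {z. gdist adj x z = i \<and> gdist adj y z = j}"

definition distance_regular :: "('v::finite \<Rightarrow> 'v \<Rightarrow> bool) \<Rightarrow> bool" where
  "distance_regular adj \<longleftrightarrow> connected_simple_graph adj \<and>
     (\<forall>i j x y x' y'. gdist adj x y = gdist adj x' y' \<longrightarrow>
        card (sphere_meet adj i j x y) = card (sphere_meet adj i j x' y'))"

text \<open>
  \<open>intersection_number adj h i j\<close> is $p^h_{ij}$; it is meaningful for distance-regular graphs
  and \<open>h \<le> diam adj\<close>.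
\<close>

definition intersection_number ::
    "('v::finite \<Rightarrow> 'v \<Rightarrow> bool) \<Rightarrow> nat \<Rightarrow> nat \<Rightarrow> nat \<Rightarrow> nat" where
  "intersection_number adj h i j =
     (THE n. \<forall>x y. gdist adj x y = h \<longrightarrow> card (sphere_meet adj i j x y) = n)"

definition almost_bipartite :: "('v::finite \<Rightarrow> 'v \<Rightarrow> bool) \<Rightarrow> bool" where
  "almost_bipartite adj \<longleftrightarrow>
     (\<forall>i < diam adj. intersection_number adj i 1 i = 0) \<and>
     intersection_number adj (diam adj) 1 (diam adj) \<noteq> 0"

definition distance_matrix :: "('v::finite \<Rightarrow> 'v \<Rightarrow> bool) \<Rightarrow> nat \<Rightarrow> real^'v^'v" where
  "distance_matrix adj i = (\<chi> x y. if gdist adj x y = i then 1 else 0)"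

text \<open>
  For a distance-regular graph this span is closed under the matrix product \<open>**\<close> and is the
  algebra generated by the adjacency matrix.
\<close>

definition bose_mesner :: "('v::finite \<Rightarrow> 'v \<Rightarrow> bool) \<Rightarrow> (real^'v^'v) set" where
  "bose_mesner adj = span (distance_matrix adj ` {..diam adj})"

definition primitive_idempotents :: "(real^'v^'v::finite) set \<Rightarrow> (real^'v^'v) set" where
  "primitive_idempotents M = {e \<in> M. e \<noteq> 0 \<and> e ** e = e \<and>
     \<not> (\<exists>f\<in>M. \<exists>g\<in>M. f \<noteq> 0 \<and> g \<noteq> 0 \<and> f ** f = f \<and> g ** g = g \<and>
          f ** g = 0 \<and> g ** f = 0 \<and> e = f + g)}"

definition hadamard :: "real^'v^'v::finite \<Rightarrow> real^'v^'v \<Rightarrow> real^'v^'v" where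
  "hadamard A B = (\<chi> x y. A $ x $ y * B $ x $ y)"

text \<open>
  \<open>q h i j\<close> is $q^h_{ij}$. When \<open>E 0, \<dots>, E D\<close> are linearly independent, as the primitive
  idempotents are, the values of \<open>q\<close> at indices up to \<open>D\<close> are uniquely determined.
\<close>

definition krein_parameters ::
    "(nat \<Rightarrow> real^'v^'v::finite) \<Rightarrow> nat \<Rightarrow> (nat \<Rightarrow> nat \<Rightarrow> nat \<Rightarrow> real) \<Rightarrow> bool" where
  "krein_parameters E D q \<longleftrightarrow>
     (\<forall>i\<le>D. \<forall>j\<le>D. hadamard (E i) (E j) = (1 / real CARD('v)) *\<^sub>R (\<Sum>h\<le>D. q h i j *\<^sub>R E h))"

definition Q_polynomial :: "('v::finite \<Rightarrow> 'v \<Rightarrow> bool) \<Rightarrow> bool" where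
  "Q_polynomial adj \<longleftrightarrow> (\<exists>E q.
     bij_betw E {..diam adj} (primitive_idempotents (bose_mesner adj)) \<and>
     E 0 = (1 / real CARD('v)) *\<^sub>R (\<chi> x y. 1) \<and>
     krein_parameters E (diam adj) q \<and>
     (\<forall>i\<le>diam adj. \<forall>j\<le>diam adj. i \<noteq> j \<longrightarrow> (q 1 i j \<noteq> 0 \<longleftrightarrow> \<bar>int i - int j\<bar> = 1)))"

definition odd_graph_verts :: "nat \<Rightarrow> nat set set" where
  "odd_graph_verts D = {S. S \<subseteq> {1..2 * D + 1} \<and> card S = D}"

definition odd_graph_adj :: "nat set \<Rightarrow> nat set \<Rightarrow> bool" where
  "odd_graph_adj S T \<longleftrightarrow> S \<inter> T = {}"

definition graph_isomorphic ::
    "'a set \<Rightarrow> ('a \<Rightarrow> 'a \<Rightarrow> bool) \<Rightarrow> 'b set \<Rightarrow> ('b \<Rightarrow> 'b \<Rightarrow> bool) \<Rightarrow> bool" where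
  "graph_isomorphic V adj W adj' \<longleftrightarrow>
     (\<exists>f. bij_betw f V W \<and> (\<forall>x\<in>V. \<forall>y\<in>V. adj x y \<longleftrightarrow> adj' (f x) (f y)))"

end

(*
  The dual eigenvalues t_i of the Q-polynomial idempotent E_1 satisfy Terwilliger's balanced set
  condition. Evaluated at pairs of vertices at distance 3 it gives a three-term recurrence for t,
  with t_(D+1) = t_D at the end because the last shell is the only one containing edges, and it
  makes the sets of neighbours of a vertex that lie closer to a vertex at distance 3 into blocks
  of symmetric 2-designs with parameters (k - 1, c_3 - 1, lambda), after removal of a point.
  Solving the recurrence with Chebyshev polynomials in a parameter z expresses k, c_3 and lambda
  through z and D. The integrality of lambda leaves no solution with z > 2 for D >= 5; for D = 3, 4
  the integrality of the sizes of the shells excludes the remaining ones. So z = 2, that is, the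
  eigenvalue of E_1 is -(k - 1), as in the Odd graph. The Odd graph is then recovered from the
  columns of E_1: the sums of two columns along the edges form a regular simplex with 2D + 1
  vertices, and a vertex of the graph corresponds to the D simplex vertices that are not labels
  of edges at it.
*)
theory Submission
  imports Defs
begin

section \<open>Distances\<close>

text \<open>Distance 3 is the first one at which the balanced set condition on neighbours goes
  beyond the eigenvalue equation, since c_1 = c_2 = 1 makes it a consequence at smaller distances.
  The parameter is z = -\<beta>, where \<beta> + 1 is the ratio of t_a - t_(a+3) to t_(a+1) -
  t_(a+2). With U_j the Chebyshev polynomial of the second kind at z/2 and \<delta> = U_(D-3) -
  U_(D-4), the decisive relation is lambda * \<delta>^2 = (z + 1)(z - 2). For z > 2 and D >= 5 the
  square of \<delta> already exceeds the right-hand side, so no positive integer lambda remains. For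
  D = 4, \<delta> = z - 1 still allows z = 3, and for D = 3, \<delta> = 1 allows every integer z >
  2; hence the recourse to shell sizes. A positive eigenvalue s would give z < 2, where this growth
  argument fails, so it is excluded beforehand by the cubic equation for s and the divisibility
  coming from the design.\<close>

locale drg =
  fixes adj :: "'v::finite \<Rightarrow> 'v \<Rightarrow> bool"
  assumes distance_regular: "distance_regular adj"
begin

abbreviation d :: "'v \<Rightarrow> 'v \<Rightarrow> nat" where "d \<equiv> gdist adj"
abbreviation D :: nat where "D \<equiv> diam adj"
abbreviation p :: "nat \<Rightarrow> nat \<Rightarrow> nat \<Rightarrow> nat" where "p \<equiv> intersection_number adj"

lemma adj_sym: "adj x y \<Longrightarrow> adj y x"
  using distance_regular by (auto simp: distance_regular_def connected_simple_graph_def dest: sympD)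

lemma adj_irrefl: "\<not> adj x x"
  using distance_regular by (auto simp: distance_regular_def connected_simple_graph_def dest: irreflpD)

lemma relpowp_gdist: "(adj ^^ d x y) x y"
proof -
  have "adj\<^sup>*\<^sup>* x y"
    using distance_regular by (auto simp: distance_regular_def connected_simple_graph_def)
  then obtain n where "(adj ^^ n) x y" by (auto simp: rtranclp_power)
  then show ?thesis unfolding gdist_def by (rule LeastI)
qed

lemma gdist_le: "(adj ^^ n) x y \<Longrightarrow> d x y \<le> n"
  unfolding gdist_def by (rule Least_le)

lemma relpowp_sym: "(adj ^^ n) x y \<Longrightarrow> (adj ^^ n) y x"
proof (induction n arbitrary: x y)
  case (Suc n)
  then obtain z where "(adj ^^ n) x z" "adj z y" by auto
  then show ?case using Suc.IH adj_sym by (meson relpowp_Suc_I2)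
qed simp

lemma d_sym: "d x y = d y x"
  by (meson gdist_le le_antisym relpowp_gdist relpowp_sym)

lemma d_triangle: "d x z \<le> d x y + d y z"
proof -
  have "(adj ^^ (d x y + d y z)) x z"
    using relpowp_gdist[of x y] relpowp_gdist[of y z] by (auto simp: relpowp_add)
  then show ?thesis by (rule gdist_le)
qed

lemma d_refl [simp]: "d x x = 0"
  using gdist_le[of 0 x x] by simp

lemma d_eq_0_iff [simp]: "d x y = 0 \<longleftrightarrow> x = y"
  using relpowp_gdist[of x y] by auto

lemma d_eq_1_iff: "d x y = 1 \<longleftrightarrow> adj x y"
proof
  assume "d x y = 1"
  then show "adj x y" using relpowp_gdist[of x y] by auto
next
  assume a: "adj x y"
  then have "d x y \<le> 1" using gdist_le[of 1 x y] by auto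
  moreover have "d x y \<noteq> 0" using a adj_irrefl by auto
  ultimately show "d x y = 1" by linarith
qed

lemma d_adj_le: "adj x y \<Longrightarrow> d x z \<le> Suc (d y z)"
  using d_triangle[of x z y] d_eq_1_iff[of x y] by simp

lemma d_split:
  assumes "d x y = i + j"
  obtains z where "d x z = i" "d z y = j"
proof -
  have "(adj ^^ (i + j)) x y" using relpowp_gdist[of x y] assms by simp
  then obtain z where z: "(adj ^^ i) x z" "(adj ^^ j) z y" by (auto simp: relpowp_add)
  then show thesis using gdist_le[OF z(1)] gdist_le[OF z(2)] d_triangle[of x y z] assms that[of z] by linarith
qed

lemma finite_dists: "finite {d x y |x y. True}"
proof -
  have "{d x y |x y. True} = range (\<lambda>(x, y). d x y)" by auto
  then show ?thesis by simp
qed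

lemma d_le_diam: "d x y \<le> D"
  unfolding diam_def by (rule Max_ge[OF finite_dists]) auto

lemma diam_attained: obtains x y where "d x y = D"
proof -
  have "D \<in> {d x y |x y. True}" unfolding diam_def by (rule Max_in[OF finite_dists]) auto
  then show thesis using that by auto
qed

lemma dist_attained: assumes "i \<le> D" obtains x y where "d x y = i"
proof -
  obtain x y where "d x y = i + (D - i)" using assms diam_attained by (metis le_add_diff_inverse)
  then show thesis by (rule d_split) (rule that)
qed

lemma card_sphere_meet: "d x y = h \<Longrightarrow> card (sphere_meet adj i j x y) = p h i j"
  unfolding intersection_number_def
  by (rule theI2[where a = "card (sphere_meet adj i j x y)"])
     (use distance_regular in \<open>auto simp: distance_regular_def\<close>)

definition nbhd :: "'v \<Rightarrow> 'v set" where "nbhd x = {z. adj x z}"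

lemma nbhd_iff: "z \<in> nbhd x \<longleftrightarrow> adj x z" by (simp add: nbhd_def)

lemma sphere_meet_1: "sphere_meet adj 1 j x y = {z \<in> nbhd x. d y z = j}"
  by (auto simp: sphere_meet_def nbhd_def d_eq_1_iff[simplified])

definition shell :: "nat \<Rightarrow> 'v \<Rightarrow> 'v set" where "shell i x = {y. d x y = i}"

text \<open>Double counting of the edges between consecutive shells. The shell sizes obtained from
  it carry the integrality conditions for small diameters.\<close>

lemma shell_edge_count:
  "card (shell i x) * p i 1 (Suc i) = card (shell (Suc i) x) * p (Suc i) 1 i"
proof -
  let ?R = "\<lambda>y z. adj y z"
  have "(\<Sum>y\<in>shell i x. card {z\<in>shell (Suc i) x. adj y z}) =
        (\<Sum>z\<in>shell (Suc i) x. card {y\<in>shell i x. adj y z})"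
    by (rule sum_multicount_gen) auto
  moreover have "card {z\<in>shell (Suc i) x. adj y z} = p i 1 (Suc i)" if "y \<in> shell i x" for y
    using card_sphere_meet[of y x i 1 "Suc i"] that
    by (auto simp: sphere_meet_1 shell_def nbhd_def d_sym conj_commute simp del: One_nat_def)
  moreover have "card {y\<in>shell i x. adj y z} = p (Suc i) 1 i" if "z \<in> shell (Suc i) x" for z
  proof -
    have "{y\<in>shell i x. adj y z} = sphere_meet adj 1 i z x"
      by (auto simp: sphere_meet_1 shell_def nbhd_def simp del: One_nat_def intro: adj_sym)
    then show ?thesis using card_sphere_meet[of z x "Suc i" 1 i] that by (simp add: shell_def d_sym)
  qed
  ultimately show ?thesis by simp
qed

end

section \<open>The Bose--Mesner algebra\<close>

lemma matrix_mult_nth: "(M ** N) $ x $ y = (\<Sum>z\<in>UNIV. M $ x $ z * N $ z $ y)"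
  by (simp add: matrix_matrix_mult_def)

lemma matrix_sum_mult: "(\<Sum>i\<in>I. F i) ** N = (\<Sum>i\<in>I. F i ** (N :: real^'n^'n))"
  by (simp add: vec_eq_iff matrix_mult_nth sum_distrib_right) (intro allI, rule sum.swap)

lemma matrix_mult_sum: "(N :: real^'n^'n) ** (\<Sum>i\<in>I. F i) = (\<Sum>i\<in>I. N ** F i)"
  by (simp add: vec_eq_iff matrix_mult_nth sum_distrib_left) (intro allI, rule sum.swap)

lemma matrix_mult_scaleR:
  "(N :: real^'n^'n) ** (a *\<^sub>R M) = a *\<^sub>R (N ** M)" "(a *\<^sub>R M) ** N = a *\<^sub>R (M ** N)"
  by (simp_all add: vec_eq_iff matrix_mult_nth sum_distrib_left mult_ac)

lemma matrix_mult_diff: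
  "(N :: real^'n^'n) ** (M - M') = N ** M - N ** M'" "(M - M') ** N = M ** N - M' ** N"
  by (simp_all add: vec_eq_iff matrix_mult_nth algebra_simps sum_subtractf)

context drg
begin

text \<open>With the algebra described by entries that depend only on the distance, symmetry and
  closure under the product follow directly from distance-regularity.\<close>

lemma bose_mesner_iff: "M \<in> bose_mesner adj \<longleftrightarrow> (\<exists>f. \<forall>x y. M $ x $ y = f (d x y))"
proof
  let ?V = "{M :: real^'v^'v. \<exists>f. \<forall>x y. M $ x $ y = f (d x y)}"
  have "subspace ?V"
  proof (rule subspaceI)
    show "0 \<in> ?V" by (auto intro!: exI[of _ "\<lambda>_. 0"])
    show "M + N \<in> ?V" if "M \<in> ?V" "N \<in> ?V" for M N
      using that by clarsimp (rule_tac x = "\<lambda>i. f i + fa i" in exI, simp)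
    show "a *\<^sub>R M \<in> ?V" if "M \<in> ?V" for a M
      using that by clarsimp (rule_tac x = "\<lambda>i. a * f i" in exI, simp)
  qed
  moreover have "distance_matrix adj ` {..D} \<subseteq> ?V"
    by (auto simp: distance_matrix_def)
  ultimately have "bose_mesner adj \<subseteq> ?V"
    unfolding bose_mesner_def by (rule span_minimal[rotated])
  then show "M \<in> bose_mesner adj \<Longrightarrow> \<exists>f. \<forall>x y. M $ x $ y = f (d x y)" by auto
next
  assume "\<exists>f. \<forall>x y. M $ x $ y = f (d x y)"
  then obtain f where f: "\<And>x y. M $ x $ y = f (d x y)" by auto
  have "M = (\<Sum>i\<le>D. f i *\<^sub>R distance_matrix adj i)"
    by (simp add: vec_eq_iff distance_matrix_def f if_distrib[of "(*) _"] d_le_diam cong: if_cong)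
  also have "\<dots> \<in> bose_mesner adj"
    unfolding bose_mesner_def by (intro span_sum span_scale span_base) auto
  finally show "M \<in> bose_mesner adj" .
qed

lemma distance_matrix_bose_mesner: "distance_matrix adj i \<in> bose_mesner adj"
  unfolding bose_mesner_iff
  by (rule exI[of _ "\<lambda>h. if h = i then 1 else 0"]) (simp add: distance_matrix_def)

text \<open>Sorting the vertices by their pair of distances leaves an expression in
  \<open>d x y\<close> alone, which is what closure under the matrix product requires.\<close>

lemma sum_dist_pair:
  fixes F :: "nat \<Rightarrow> nat \<Rightarrow> real"
  shows "(\<Sum>z\<in>UNIV. F (d x z) (d y z)) = (\<Sum>i\<le>D. \<Sum>j\<le>D. F i j * p (d x y) i j)"
proof -
  have "F (d x z) (d y z) = (\<Sum>i\<le>D. \<Sum>j\<le>D. if d x z = i \<and> d y z = j then F i j else 0)" for z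
  proof -
    have "(\<Sum>j\<le>D. if d x z = i \<and> d y z = j then F i j else 0) = (if d x z = i then F i (d y z) else 0)" for i
      by (cases "d x z = i") (auto simp: d_le_diam)
    then show ?thesis by (simp add: d_le_diam)
  qed
  then have "(\<Sum>z\<in>UNIV. F (d x z) (d y z)) =
      (\<Sum>z\<in>UNIV. \<Sum>i\<le>D. \<Sum>j\<le>D. if d x z = i \<and> d y z = j then F i j else 0)" by simp
  also have "\<dots> = (\<Sum>i\<le>D. \<Sum>z\<in>UNIV. \<Sum>j\<le>D. if d x z = i \<and> d y z = j then F i j else 0)"
    by (rule sum.swap)
  also have "\<dots> = (\<Sum>i\<le>D. \<Sum>j\<le>D. \<Sum>z\<in>UNIV. if d x z = i \<and> d y z = j then F i j else 0)"
    by (intro sum.cong refl sum.swap)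
  also have "\<dots> = (\<Sum>i\<le>D. \<Sum>j\<le>D. F i j * p (d x y) i j)"
    by (intro sum.cong refl)
       (simp add: sum.If_cases card_sphere_meet[OF refl, symmetric] sphere_meet_def)
  finally show ?thesis .
qed

lemma bose_mesner_mult:
  assumes "M \<in> bose_mesner adj" "N \<in> bose_mesner adj"
  shows "M ** N \<in> bose_mesner adj"
proof -
  obtain f g where "\<And>x y. M $ x $ y = f (d x y)" "\<And>x y. N $ x $ y = g (d x y)"
    using assms by (auto simp: bose_mesner_iff)
  then have "(M ** N) $ x $ y = (\<Sum>i\<le>D. \<Sum>j\<le>D. f i * g j * p (d x y) i j)" for x y
    using sum_dist_pair[of "\<lambda>i j. f i * g j" x y] by (simp add: matrix_mult_nth d_sym[of y])
  then show ?thesis unfolding bose_mesner_iff by (intro exI allI)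
qed

lemma bose_mesner_sym: "M \<in> bose_mesner adj \<Longrightarrow> M $ x $ y = M $ y $ x"
  by (metis bose_mesner_iff d_sym)

lemma bose_mesner_transpose: "M \<in> bose_mesner adj \<Longrightarrow> transpose M = M"
  by (simp add: vec_eq_iff transpose_def bose_mesner_sym)

lemma bose_mesner_commute:
  assumes "M \<in> bose_mesner adj" "N \<in> bose_mesner adj"
  shows "M ** N = N ** M"
  using bose_mesner_transpose[OF bose_mesner_mult[OF assms]] assms
  by (simp add: matrix_transpose_mul bose_mesner_transpose)

lemma subspace_bose_mesner: "subspace (bose_mesner adj)"
  by (simp add: bose_mesner_def subspace_span)

lemma dim_bose_mesner_le: "dim (bose_mesner adj) \<le> Suc D"
proof -
  have "dim (bose_mesner adj) \<le> card (distance_matrix adj ` {..D})"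
    by (rule dim_le_card) (auto simp: bose_mesner_def)
  also have "\<dots> \<le> Suc D" using card_image_le[of "{..D}"] by (metis card_atMost finite_atMost)
  finally show ?thesis .
qed

text \<open>\<open>e\<close> is the sum of the orthogonal idempotents \<open>e ** f\<close> and
  \<open>e - e ** f\<close>, so primitivity makes one of them vanish.\<close>

lemma primitive_idempotent_absorb:
  assumes e: "e \<in> primitive_idempotents (bose_mesner adj)"
    and f: "f \<in> bose_mesner adj" "f ** f = f"
  shows "e ** f = 0 \<or> e ** f = e"
proof (rule ccontr)
  assume n: "\<not> ?thesis"
  have eB: "e \<in> bose_mesner adj" and ee: "e ** e = e"
    using e by (auto simp: primitive_idempotents_def)
  let ?g = "e ** f" and ?h = "e - e ** f"
  have fe: "f ** e = e ** f" by (rule bose_mesner_commute[OF f(1) eB])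
  have 1: "?g ** ?g = ?g"
    by (metis ee f(2) fe matrix_mul_assoc)
  have 2: "?g ** e = ?g" "e ** ?g = ?g"
    by (metis ee fe matrix_mul_assoc)+
  have "?g \<in> bose_mesner adj" "?h \<in> bose_mesner adj"
    using bose_mesner_mult[OF eB f(1)] subspace_diff[OF subspace_bose_mesner eB] by auto
  moreover have "?g \<noteq> 0" "?h \<noteq> 0" using n by auto
  moreover have "?g ** ?g = ?g" "?h ** ?h = ?h" "?g ** ?h = 0" "?h ** ?g = 0" "e = ?g + ?h"
    using 1 2 ee by (auto simp: matrix_mult_diff)
  ultimately show False
    using e unfolding primitive_idempotents_def by blast
qed

lemma primitive_idempotents_orthogonal:
  assumes e: "e \<in> primitive_idempotents (bose_mesner adj)"
    and f: "f \<in> primitive_idempotents (bose_mesner adj)" and ne: "e \<noteq> f"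
  shows "e ** f = 0"
proof (rule ccontr)
  assume n: "e ** f \<noteq> 0"
  have B: "e \<in> bose_mesner adj" "e ** e = e" "f \<in> bose_mesner adj" "f ** f = f"
    using e f by (auto simp: primitive_idempotents_def)
  have c: "e ** f = f ** e" using B bose_mesner_commute by blast
  have "e ** f = e" using primitive_idempotent_absorb[OF e B(3,4)] n by blast
  moreover have "f ** e = f" using primitive_idempotent_absorb[OF f B(1,2)] n c by auto
  ultimately show False using c ne by simp
qed

end

section \<open>The Q-polynomial ordering of the primitive idempotents\<close>

locale qpoly_drg = drg adj for adj :: "'v::finite \<Rightarrow> 'v \<Rightarrow> bool" +
  fixes E :: "nat \<Rightarrow> real^'v^'v" and q :: "nat \<Rightarrow> nat \<Rightarrow> nat \<Rightarrow> real"
  assumes bij_E: "bij_betw E {..D} (primitive_idempotents (bose_mesner adj))"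
    and E_0: "E 0 = (1 / real CARD('v)) *\<^sub>R (\<chi> x y. 1)"
    and krein: "krein_parameters E D q"
    and q1_nonzero_iff: "\<And>i j. i \<le> D \<Longrightarrow> j \<le> D \<Longrightarrow> i \<noteq> j \<Longrightarrow> q 1 i j \<noteq> 0 \<longleftrightarrow> \<bar>int i - int j\<bar> = 1"
    and D_pos: "1 \<le> D"
begin

lemma E_prim: "i \<le> D \<Longrightarrow> E i \<in> primitive_idempotents (bose_mesner adj)"
  using bij_E by (auto simp: bij_betw_def)

lemma E_props:
  assumes "i \<le> D"
  shows E_BM: "E i \<in> bose_mesner adj" and E_nz: "E i \<noteq> 0" and E_idem: "E i ** E i = E i"
  using E_prim[OF assms] by (auto simp: primitive_idempotents_def)

lemma E_orth: "i \<le> D \<Longrightarrow> j \<le> D \<Longrightarrow> i \<noteq> j \<Longrightarrow> E i ** E j = 0"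
  using primitive_idempotents_orthogonal[OF E_prim E_prim] bij_E
  by (auto simp: bij_betw_def inj_on_def)

lemma E_mult: "i \<le> D \<Longrightarrow> j \<le> D \<Longrightarrow> E i ** E j = (if i = j then E i else 0)"
  using E_orth E_idem by auto

lemma sum_E_mult:
  assumes "j \<le> D"
  shows "(\<Sum>i\<le>D. a i *\<^sub>R E i) ** E j = a j *\<^sub>R E j"
proof -
  have "(\<Sum>i\<le>D. a i *\<^sub>R E i) ** E j = (\<Sum>i\<le>D. if i = j then a j *\<^sub>R E j else 0)"
    unfolding matrix_sum_mult by (rule sum.cong) (auto simp: matrix_mult_scaleR E_mult assms)
  then show ?thesis using assms by simp
qed

text \<open>Orthogonality makes the \<open>D + 1\<close> idempotents independent, and the dimension
  is at most \<open>D + 1\<close>.\<close>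

lemma bose_mesner_eq_span_E: "bose_mesner adj \<subseteq> span (E ` {..D})"
proof (rule card_ge_dim_independent)
  have inj: "inj_on E {..D}" using bij_E by (simp add: bij_betw_def)
  show "E ` {..D} \<subseteq> bose_mesner adj" using E_BM by auto
  show "dim (bose_mesner adj) \<le> card (E ` {..D})"
    using dim_bose_mesner_le inj by (simp add: card_image)
  show "independent (E ` {..D})"
  proof (rule independent_if_scalars_zero)
    fix f M assume f: "(\<Sum>M\<in>E ` {..D}. f M *\<^sub>R M) = 0" and "M \<in> E ` {..D}"
    then obtain j where j: "M = E j" "j \<le> D" by auto
    have "(\<Sum>i\<le>D. f (E i) *\<^sub>R E i) = 0" using f by (simp add: sum.reindex[OF inj])
    then have "f (E j) *\<^sub>R E j = 0" using sum_E_mult[OF j(2), of "\<lambda>i. f (E i)"]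
      by (simp add: vec_eq_iff matrix_mult_nth)
    then show "f M = 0" using E_nz j by simp
  qed simp
qed

lemma E_expansion:
  assumes "M \<in> bose_mesner adj"
  obtains a where "M = (\<Sum>i\<le>D. a i *\<^sub>R E i)"
proof -
  have inj: "inj_on E {..D}" using bij_E by (simp add: bij_betw_def)
  have "M \<in> span (E ` {..D})" using assms bose_mesner_eq_span_E by blast
  then obtain u where "M = (\<Sum>v\<in>E ` {..D}. u v *\<^sub>R v)" using span_finite[of "E ` {..D}"] by auto
  then have "M = (\<Sum>i\<le>D. u (E i) *\<^sub>R E i)" by (simp add: sum.reindex[OF inj])
  then show thesis by (rule that)
qed

lemma sum_E: "(\<Sum>i\<le>D. E i) = mat 1"
proof -
  have "mat 1 \<in> bose_mesner adj"
    unfolding bose_mesner_iff by (rule exI[of _ "\<lambda>i. if i = 0 then 1 else 0"]) (simp add: mat_def)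
  then obtain a where a: "mat 1 = (\<Sum>i\<le>D. a i *\<^sub>R E i)" by (rule E_expansion)
  have "a j = 1" if "j \<le> D" for j
    using sum_E_mult[OF that, of a] E_nz[OF that] scaleR_cancel_right[of "a j" "E j" 1] by (simp flip: a)
  then show ?thesis using a by simp
qed

lemma krein_entry:
  assumes "i \<le> D" "j \<le> D"
  shows "E i $ x $ y * E j $ x $ y = (\<Sum>h\<le>D. q h i j * E h $ x $ y) / real CARD('v)"
proof -
  have "hadamard (E i) (E j) = (1 / real CARD('v)) *\<^sub>R (\<Sum>h\<le>D. q h i j *\<^sub>R E h)"
    using krein assms by (simp add: krein_parameters_def)
  then have "hadamard (E i) (E j) $ x $ y = ((1 / real CARD('v)) *\<^sub>R (\<Sum>h\<le>D. q h i j *\<^sub>R E h)) $ x $ y"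
    by simp
  then show ?thesis by (simp add: hadamard_def)
qed

end

text \<open>Antisymmetry kills the diagonal, so the sum depends only on the superdiagonal
  coefficients. In \<open>balanced_set\<close> this allows one antisymmetric system of coefficients
  to be traded for another.\<close>

lemma sum_tridiagonal_antisymmetric:
  fixes F :: "nat \<Rightarrow> nat \<Rightarrow> 'a::real_vector" and g :: "nat \<Rightarrow> nat \<Rightarrow> real"
  assumes F: "\<And>a b. a \<le> n \<Longrightarrow> b \<le> n \<Longrightarrow> Suc a < b \<or> Suc b < a \<Longrightarrow> F a b = 0"
    and g: "\<And>a b. g a b = - g b a"
  shows "(\<Sum>a\<le>n. \<Sum>b\<le>n. g a b *\<^sub>R F a b) =
    (\<Sum>a<n. g a (Suc a) *\<^sub>R (F a (Suc a) - F (Suc a) a))"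
  using F
proof (induction n)
  case 0
  then show ?case using g[of 0 0] by simp
next
  case (Suc n)
  have z: "(\<Sum>a\<le>n. g a (Suc n) *\<^sub>R F a (Suc n)) = g n (Suc n) *\<^sub>R F n (Suc n)"
    "(\<Sum>b\<le>n. g (Suc n) b *\<^sub>R F (Suc n) b) = g (Suc n) n *\<^sub>R F (Suc n) n"
    by (rule trans[OF sum.mono_neutral_right[of _ "{n}"]], auto intro!: Suc.prems)+
  have "(\<Sum>a\<le>Suc n. \<Sum>b\<le>Suc n. g a b *\<^sub>R F a b) =
      (\<Sum>a\<le>n. \<Sum>b\<le>n. g a b *\<^sub>R F a b) + g n (Suc n) *\<^sub>R F n (Suc n)
      + g (Suc n) n *\<^sub>R F (Suc n) n + g (Suc n) (Suc n) *\<^sub>R F (Suc n) (Suc n)"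
    by (simp add: sum.distrib z)
  also have "g (Suc n) (Suc n) = 0" using g[of "Suc n" "Suc n"] by simp
  also have "g (Suc n) n = - g n (Suc n)" by (rule g)
  finally show ?case using Suc by (simp add: algebra_simps)
qed

section \<open>Dual eigenvalues and Krein parameters\<close>

context qpoly_drg
begin

text \<open>\<open>t i\<close> is the i-th dual eigenvalue divided by the number of vertices; beyond
  \<open>D\<close> the values are arbitrary.\<close>

definition t :: "nat \<Rightarrow> real" where "t = (SOME f. \<forall>x y. E 1 $ x $ y = f (d x y))"

lemma E_1_entry: "E (Suc 0) $ x $ y = t (d x y)"
proof -
  have "\<exists>f. \<forall>x y. E 1 $ x $ y = f (d x y)" using E_BM D_pos bose_mesner_iff by blast
  from someI_ex[OF this] show ?thesis unfolding t_def One_nat_def by blast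
qed

lemma E_row: "h \<le> D \<Longrightarrow> (\<Sum>z\<in>UNIV. E h $ x $ z * E h $ z $ y) = E h $ x $ y"
  using matrix_mult_nth[of "E h" "E h" x y] by (simp add: E_idem)

lemma t_idem: "(\<Sum>z\<in>UNIV. t (d x z) * t (d z y)) = t (d x y)"
  using E_row[of 1 x y] D_pos by (simp add: E_1_entry)

lemma t_0_pos: "t 0 > 0"
proof -
  have sq: "t 0 = (\<Sum>z\<in>UNIV. (t (d x z))\<^sup>2)" for x
    using t_idem[of x x] by (simp add: power2_eq_square d_sym)
  have nn: "t 0 \<ge> 0" using sq sum_nonneg[of UNIV] by (metis zero_le_power2)
  have "t 0 \<noteq> 0"
  proof
    assume "t 0 = 0"
    then have "t (d x z) = 0" for x z
      using sq[of x] sum_nonneg_eq_0_iff[of UNIV "\<lambda>z. (t (d x z))\<^sup>2"] by simp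
    then have "E (Suc 0) = 0" by (simp add: vec_eq_iff E_1_entry)
    then show False using E_nz[of 1] D_pos by simp
  qed
  then show ?thesis using nn by simp
qed

lemma t_eigenvector: "\<exists>s. \<forall>x y. (\<Sum>z\<in>nbhd x. t (d z y)) = s * t (d x y)"
proof -
  let ?A = "distance_matrix adj 1"
  obtain a where "?A = (\<Sum>i\<le>D. a i *\<^sub>R E i)"
    using E_expansion[OF distance_matrix_bose_mesner] .
  then have "?A ** E 1 = a 1 *\<^sub>R E 1" using sum_E_mult[of 1 a] D_pos by simp
  then have eq: "(?A ** E 1) $ x $ y = a 1 * t (d x y)" for x y
    by (metis E_1_entry One_nat_def real_scaleR_def vector_scaleR_component)
  have "(?A ** E 1) $ x $ y = (\<Sum>z\<in>nbhd x. t (d z y))" for x y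
  proof -
    have "(?A ** E 1) $ x $ y = (\<Sum>z\<in>UNIV. if z \<in> nbhd x then t (d z y) else 0)"
      unfolding matrix_mult_nth
      by (intro sum.cong refl) (simp add: distance_matrix_def E_1_entry nbhd_iff d_eq_1_iff[simplified])
    then show ?thesis by (simp add: sum.If_cases)
  qed
  then have "\<forall>x y. (\<Sum>z\<in>nbhd x. t (d z y)) = a 1 * t (d x y)" using eq by simp
  then show ?thesis ..
qed

lemma trace_E_pos: assumes "h \<le> D" shows "0 < (\<Sum>x\<in>UNIV. E h $ x $ x)"
proof -
  have "E h $ x $ x = (\<Sum>y\<in>UNIV. (E h $ x $ y)\<^sup>2)" for x
    unfolding E_row[OF assms, symmetric, of x x] power2_eq_square
    by (intro sum.cong refl) (simp add: bose_mesner_sym[OF E_BM[OF assms], of x])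
  then have eq: "(\<Sum>x\<in>UNIV. E h $ x $ x) = (\<Sum>x\<in>UNIV. \<Sum>y\<in>UNIV. (E h $ x $ y)\<^sup>2)" by simp
  obtain x y where "E h $ x $ y \<noteq> 0" using E_nz[OF assms] by (auto simp: vec_eq_iff)
  then have "0 < (\<Sum>y\<in>UNIV. (E h $ x $ y)\<^sup>2)"
    by (intro sum_pos2[of _ y]) auto
  then have "0 < (\<Sum>x\<in>UNIV. \<Sum>y\<in>UNIV. (E h $ x $ y)\<^sup>2)"
    by (rule sum_pos2[OF finite UNIV_I]) (rule sum_nonneg, simp)
  then show ?thesis unfolding eq .
qed

text \<open>Pairing the Krein expansion with \<open>E h\<close> entrywise isolates the coefficient
  at \<open>h\<close>. The left-hand side is symmetric in all three indices.\<close>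

lemma krein_trace:
  assumes "h \<le> D" "i \<le> D" "j \<le> D"
  shows "(\<Sum>x\<in>UNIV. \<Sum>y\<in>UNIV. E h $ x $ y * (E i $ x $ y * E j $ x $ y)) =
    q h i j * (\<Sum>x\<in>UNIV. E h $ x $ x) / real CARD('v)"
proof -
  have tr: "(\<Sum>x\<in>UNIV. \<Sum>y\<in>UNIV. E h $ x $ y * E g $ x $ y) =
      (if g = h then (\<Sum>x\<in>UNIV. E h $ x $ x) else 0)" if "g \<le> D" for g
  proof -
    have "(\<Sum>y\<in>UNIV. E h $ x $ y * E g $ x $ y) = (E h ** E g) $ x $ x" for x
      unfolding matrix_mult_nth by (intro sum.cong refl) (metis bose_mesner_sym[OF E_BM[OF that]])
    then show ?thesis by (simp add: E_mult that assms)
  qed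
  have "(\<Sum>x\<in>UNIV. \<Sum>y\<in>UNIV. E h $ x $ y * (E i $ x $ y * E j $ x $ y)) =
     (\<Sum>x\<in>UNIV. \<Sum>y\<in>UNIV. \<Sum>g\<le>D. q g i j / real CARD('v) * (E h $ x $ y * E g $ x $ y))"
    by (simp add: krein_entry assms sum_distrib_left sum_divide_distrib mult_ac)
  also have "\<dots> = (\<Sum>g\<le>D. \<Sum>x\<in>UNIV. \<Sum>y\<in>UNIV. q g i j / real CARD('v) * (E h $ x $ y * E g $ x $ y))"
    by (subst sum.swap[of _ "{..D}" UNIV], subst (2) sum.swap) (rule refl)
  also have "\<dots> = (\<Sum>g\<le>D. q g i j / real CARD('v) * (\<Sum>x\<in>UNIV. \<Sum>y\<in>UNIV. E h $ x $ y * E g $ x $ y))"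
    by (simp only: sum_distrib_left)
  also have "\<dots> = (\<Sum>g\<le>D. if g = h then q h i j / real CARD('v) * (\<Sum>x\<in>UNIV. E h $ x $ x) else 0)"
    by (intro sum.cong refl) (simp add: tr)
  finally show ?thesis using assms by simp
qed

lemma krein_sym:
  assumes "h \<le> D" "i \<le> D" "j \<le> D"
  shows "q h i j * (\<Sum>x\<in>UNIV. E h $ x $ x) = q i h j * (\<Sum>x\<in>UNIV. E i $ x $ x)"
proof -
  have "q h i j * (\<Sum>x\<in>UNIV. E h $ x $ x) / real CARD('v) =
        q i h j * (\<Sum>x\<in>UNIV. E i $ x $ x) / real CARD('v)"
    using krein_trace[of h i j] krein_trace[of i h j] assms by (simp add: mult_ac)
  then show ?thesis by simp
qed

text \<open>The Q-polynomial condition restricts q^1_hj, whereas the entrywise product of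
  \<open>E 1\<close> and \<open>E j\<close> involves q^h_1j. Symmetry and the positive traces carry
  the vanishing over.\<close>

lemma krein_zero_iff:
  assumes "h \<le> D" "j \<le> D" "h \<noteq> j"
  shows "q h 1 j = 0 \<longleftrightarrow> \<bar>int h - int j\<bar> \<noteq> 1"
proof -
  have "q h 1 j = 0 \<longleftrightarrow> q 1 h j = 0"
  proof -
    have *: "a = 0 \<longleftrightarrow> b = 0" if "a * r = b * r'" "0 < r" "0 < r'" for a b r r' :: real
      using that by auto
    show ?thesis
      by (rule *[OF krein_sym[OF assms(1) D_pos assms(2)] trace_E_pos[OF assms(1)] trace_E_pos[OF D_pos]])
  qed
  then show ?thesis using q1_nonzero_iff[OF assms] by blast
qed


end

lemma sum_swap_pairs:
  "(\<Sum>z\<in>A. \<Sum>w\<in>B. \<Sum>v\<in>C. \<Sum>u\<in>G. f z w v u) = (\<Sum>v\<in>C. \<Sum>u\<in>G. \<Sum>z\<in>A. \<Sum>w\<in>B. f z w v u)"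
proof -
  have "(\<Sum>z\<in>A. \<Sum>w\<in>B. \<Sum>v\<in>C. \<Sum>u\<in>G. f z w v u) = (\<Sum>z\<in>A. \<Sum>v\<in>C. \<Sum>w\<in>B. \<Sum>u\<in>G. f z w v u)"
    by (intro sum.cong refl sum.swap)
  also have "\<dots> = (\<Sum>v\<in>C. \<Sum>z\<in>A. \<Sum>w\<in>B. \<Sum>u\<in>G. f z w v u)"
    by (rule sum.swap)
  also have "\<dots> = (\<Sum>v\<in>C. \<Sum>z\<in>A. \<Sum>u\<in>G. \<Sum>w\<in>B. f z w v u)"
    by (intro sum.cong refl sum.swap)
  also have "\<dots> = (\<Sum>v\<in>C. \<Sum>u\<in>G. \<Sum>z\<in>A. \<Sum>w\<in>B. f z w v u)"
    by (intro sum.cong refl sum.swap)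
  finally show ?thesis .
qed

context qpoly_drg begin

text \<open>The Hadamard powers of \<open>E 1\<close> reach every \<open>E a\<close>, so equal dual eigenvalues would
  make all of \<open>bose_mesner adj\<close> agree at two distances.\<close>

lemma E_agree:
  assumes "t (d x y) = t (d x' y')" "a \<le> D"
  shows "E a $ x $ y = E a $ x' $ y'"
  using assms(2)
proof (induction a rule: less_induct)
  case (less a)
  consider "a = 0" | "a = 1" | b where "a = Suc b" "1 \<le> b"
    by (metis One_nat_def Suc_le_eq not0_implies_Suc not_gr_zero)
  then show ?case
  proof cases
    case 1 then show ?thesis by (simp add: E_0)
  next
    case 2 then show ?thesis using assms(1) by (simp add: E_1_entry)
  next
    case 3
    let ?S = "\<lambda>x y. \<Sum>h<a. q h 1 b * E h $ x $ y"
    have ex: "real CARD('v) * (E 1 $ x $ y * E b $ x $ y) = ?S x y + q a 1 b * E a $ x $ y" for x y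
    proof -
      \<comment> \<open>The coefficients beyond index \<open>a = Suc b\<close> vanish, so
        \<open>E a\<close> is the last term and can be solved for.\<close>
      have "(\<Sum>h\<le>D. q h 1 b * E h $ x $ y) = (\<Sum>h\<le>a. q h 1 b * E h $ x $ y)"
        using less.prems 3 krein_zero_iff[of _ b]
        by (intro sum.mono_neutral_right) (auto simp: Suc_le_eq)
      then show ?thesis using krein_entry[OF D_pos, of b x y] 3 less.prems
        by (simp add: field_simps flip: lessThan_Suc_atMost)
    qed
    have "?S x y = ?S x' y'" using less by (intro sum.cong) auto
    moreover have "E 1 $ x $ y = E 1 $ x' $ y'" using assms(1) by (simp add: E_1_entry)
    moreover have "E b $ x $ y = E b $ x' $ y'" using less 3 by auto
    ultimately have "q a 1 b * E a $ x $ y = q a 1 b * E a $ x' $ y'"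
      using ex[of x y] ex[of x' y'] by simp
    moreover have "q a 1 b \<noteq> 0" using krein_zero_iff[of a b] 3 less.prems by auto
    ultimately show ?thesis by simp
  qed
qed

lemma t_inj: "inj_on t {..D}"
proof (rule inj_onI, simp)
  fix i j assume ij: "i \<le> D" "j \<le> D" "t i = t j"
  obtain x y where xy: "d x y = i" using dist_attained ij(1) by blast
  obtain x' y' where xy': "d x' y' = j" using dist_attained ij(2) by blast
  obtain a where a: "distance_matrix adj i = (\<Sum>i\<le>D. a i *\<^sub>R E i)"
    using E_expansion[OF distance_matrix_bose_mesner] .
  have "distance_matrix adj i $ x $ y = distance_matrix adj i $ x' $ y'"
    unfolding a using E_agree[of x y x' y'] ij xy xy' by simp
  then show "i = j" using xy xy' by (auto simp: distance_matrix_def split: if_splits)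
qed

section \<open>Dual adjacency matrices and the balanced set condition\<close>

definition dual_adj :: "'v \<Rightarrow> real^'v^'v" where
  "dual_adj u = (\<chi> z w. if z = w then t (d u z) else 0)"

lemma mult_dual_adj_mult:
  "(M ** dual_adj u ** N) $ x $ y = (\<Sum>z\<in>UNIV. M $ x $ z * t (d u z) * N $ z $ y)"
  by (simp add: matrix_mult_nth dual_adj_def if_distrib[of "(*) _"] cong: if_cong)

text \<open>Up to the factor 1/|X|, \<open>dual_adj u\<close> is Terwilliger's dual adjacency
  matrix. The squared Frobenius norm of the product is the sum over h of q^h_ab (E_1 E_h E_1)_uu /
  |X|; orthogonality leaves only h = 1, and q^1_ab = 0 for these indices.\<close>

lemma E_dual_adj_E_zero:
  assumes ab: "a \<le> D" "b \<le> D" "Suc a < b \<or> Suc b < a"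
  shows "E a ** dual_adj u ** E b = 0"
proof -
  let ?M = "E a ** dual_adj u ** E b"
  let ?g = "\<lambda>v. t (d u v)"
  have sym: "E h $ v $ w = E h $ w $ v" if "h \<le> D" for h v w
    using bose_mesner_sym[OF E_BM[OF that]] .
  have q0: "q 1 a b = 0" using q1_nonzero_iff[OF ab(1,2)] ab(3) by auto
  have sq: "(\<Sum>z\<in>UNIV. E h $ z $ v * E h $ z $ w) = E h $ v $ w" if "h \<le> D" for h v w
    unfolding E_row[OF that, symmetric, of v w]
    by (intro sum.cong refl) (simp add: sym[OF that, of v])
  have "(\<Sum>z\<in>UNIV. \<Sum>w\<in>UNIV. (?M $ z $ w)\<^sup>2) =
     (\<Sum>z\<in>UNIV. \<Sum>w\<in>UNIV. \<Sum>v\<in>UNIV. \<Sum>v'\<in>UNIV. (?g v * ?g v') *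
        ((E a $ z $ v * E a $ z $ v') * (E b $ w $ v * E b $ w $ v')))"
    by (intro sum.cong refl)
       (simp add: mult_dual_adj_mult power2_eq_square sum_product sym[OF ab(2)] mult_ac)
  also have "\<dots> = (\<Sum>v\<in>UNIV. \<Sum>v'\<in>UNIV. \<Sum>z\<in>UNIV. \<Sum>w\<in>UNIV. (?g v * ?g v') *
        ((E a $ z $ v * E a $ z $ v') * (E b $ w $ v * E b $ w $ v')))"
    by (rule sum_swap_pairs)
  also have "\<dots> = (\<Sum>v\<in>UNIV. \<Sum>v'\<in>UNIV. (?g v * ?g v') *
      ((\<Sum>z\<in>UNIV. E a $ z $ v * E a $ z $ v') * (\<Sum>w\<in>UNIV. E b $ w $ v * E b $ w $ v')))"
    by (simp only: sum_product) (simp only: sum_distrib_left)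
  also have "\<dots> = (\<Sum>v\<in>UNIV. \<Sum>v'\<in>UNIV. (?g v * ?g v') * ((\<Sum>h\<le>D. q h a b * E h $ v $ v') / real CARD('v)))"
    by (simp add: sq ab krein_entry)
  also have "\<dots> = (\<Sum>v\<in>UNIV. \<Sum>v'\<in>UNIV. \<Sum>h\<le>D. q h a b / real CARD('v) * (?g v * E h $ v $ v' * ?g v'))"
    by (simp add: sum_distrib_left sum_divide_distrib mult_ac)
  also have "\<dots> = (\<Sum>h\<le>D. \<Sum>v\<in>UNIV. \<Sum>v'\<in>UNIV. q h a b / real CARD('v) * (?g v * E h $ v $ v' * ?g v'))"
    by (subst sum.swap[of _ "{..D}" UNIV], subst (2) sum.swap) (rule refl)
  also have "\<dots> = (\<Sum>h\<le>D. q h a b / real CARD('v) * (E 1 ** E h ** E 1) $ u $ u)"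
  proof (intro sum.cong refl)
    fix h
    have "(E 1 ** E h ** E 1) $ u $ u = (\<Sum>v'\<in>UNIV. \<Sum>v\<in>UNIV. ?g v * E h $ v $ v' * ?g v')"
      by (simp add: matrix_mult_nth E_1_entry sum_distrib_right d_sym[of _ u])
    also have "\<dots> = (\<Sum>v\<in>UNIV. \<Sum>v'\<in>UNIV. ?g v * E h $ v $ v' * ?g v')"
      by (rule sum.swap)
    finally show "(\<Sum>v\<in>UNIV. \<Sum>v'\<in>UNIV. q h a b / real CARD('v) * (?g v * E h $ v $ v' * ?g v')) =
      q h a b / real CARD('v) * (E 1 ** E h ** E 1) $ u $ u"
      by (simp only: sum_distrib_left)
  qed
  also have "\<dots> = 0"
    by (rule sum.neutral) (use q0 E_mult D_pos in \<open>auto simp: E_mult\<close>)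
  finally have "(\<Sum>z\<in>UNIV. \<Sum>w\<in>UNIV. (?M $ z $ w)\<^sup>2) = 0" .
  then have "?M $ z $ w = 0" for z w
    by (simp add: sum_nonneg_eq_0_iff sum_nonneg)
  then show ?thesis by (simp add: vec_eq_iff)
qed

text \<open>Commutators \<open>[Y, A\<^sup>*]\<close> with \<open>Y\<close> in the Bose--Mesner algebra already give every tridiagonal
  antisymmetric combination of the \<open>E a ** A\<^sup>* ** E b\<close>; here \<open>A\<^sup>*\<close> is \<open>dual_adj u\<close>.\<close>

lemma balanced_set:
  "\<exists>K. \<forall>x y u. d x y = h \<longrightarrow>
     (\<Sum>z\<in>sphere_meet adj i j x y. t (d z u)) - (\<Sum>z\<in>sphere_meet adj j i x y. t (d z u))
       = K * (t (d x u) - t (d y u))"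
proof -
  obtain a where a: "distance_matrix adj i = (\<Sum>l\<le>D. a l *\<^sub>R E l)"
    using E_expansion[OF distance_matrix_bose_mesner] .
  obtain b where b: "distance_matrix adj j = (\<Sum>l\<le>D. b l *\<^sub>R E l)"
    using E_expansion[OF distance_matrix_bose_mesner] .
  define g where "g l l' = a l * b l' - b l * a l'" for l l'
  \<comment> \<open>Chosen so that \<open>y l - y (Suc l) = g l (Suc l)\<close>: the differences of
    \<open>y\<close> agree with \<open>g\<close> next to the diagonal.\<close>
  define y where "y l = - (\<Sum>r<l. g r (Suc r))" for l
  define Y where "Y = (\<Sum>l\<le>D. y l *\<^sub>R E l)"
  have "Y \<in> bose_mesner adj" unfolding Y_def
    by (intro subspace_sum[OF subspace_bose_mesner] subspace_scale[OF subspace_bose_mesner] E_BM) auto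
  then obtain f where f: "\<And>v w. Y $ v $ w = f (d v w)" by (auto simp: bose_mesner_iff)
  \<comment> \<open>The entry at (v, w) of the commutator of \<open>Y\<close> with
    \<open>dual_adj u\<close> is \<open>f h * (t (d w u) - t (d v u))\<close>, whence the constant
    \<open>- f h\<close>.\<close>
  have "(\<Sum>z\<in>sphere_meet adj i j v w. t (d z u)) - (\<Sum>z\<in>sphere_meet adj j i v w. t (d z u))
       = - f h * (t (d v u) - t (d w u))" if "d v w = h" for v w u
  proof -
    define F where "F l l' = E l ** dual_adj u ** E l'" for l l'
    have prod: "(\<Sum>l\<le>D. a' l *\<^sub>R E l) ** dual_adj u ** (\<Sum>l\<le>D. b' l *\<^sub>R E l)
        = (\<Sum>l\<le>D. \<Sum>l'\<le>D. (a' l * b' l') *\<^sub>R F l l')" for a' b'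
    proof -
      have "(\<Sum>l\<le>D. a' l *\<^sub>R E l) ** dual_adj u ** (\<Sum>l\<le>D. b' l *\<^sub>R E l)
          = (\<Sum>l'\<le>D. \<Sum>l\<le>D. (a' l * b' l') *\<^sub>R F l l')"
        by (simp add: matrix_sum_mult matrix_mult_sum matrix_mult_scaleR F_def scaleR_sum_right mult.commute)
      also have "\<dots> = (\<Sum>l\<le>D. \<Sum>l'\<le>D. (a' l * b' l') *\<^sub>R F l l')" by (rule sum.swap)
      finally show ?thesis .
    qed
    have tri: "(\<Sum>l\<le>D. \<Sum>l'\<le>D. g' l l' *\<^sub>R F l l') =
       (\<Sum>l<D. g' l (Suc l) *\<^sub>R (F l (Suc l) - F (Suc l) l))" if "\<And>l l'. g' l l' = - g' l' l" for g'
      by (rule sum_tridiagonal_antisymmetric[OF _ that]) (auto simp: F_def intro: E_dual_adj_E_zero)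
    have "distance_matrix adj i ** dual_adj u ** distance_matrix adj j
        - distance_matrix adj j ** dual_adj u ** distance_matrix adj i
        = (\<Sum>l\<le>D. \<Sum>l'\<le>D. g l l' *\<^sub>R F l l')"
      unfolding a b prod g_def by (simp add: sum_subtractf scaleR_left_diff_distrib)
    also have "\<dots> = (\<Sum>l<D. g l (Suc l) *\<^sub>R (F l (Suc l) - F (Suc l) l))"
      by (rule tri) (simp add: g_def)
    also have "\<dots> = (\<Sum>l<D. (y l - y (Suc l)) *\<^sub>R (F l (Suc l) - F (Suc l) l))"
      by (simp add: y_def)
    also have "\<dots> = (\<Sum>l\<le>D. \<Sum>l'\<le>D. (y l - y l') *\<^sub>R F l l')"
      by (rule tri[symmetric]) simp
    \<comment> \<open>Writing \<open>mat 1\<close> as the sum of all \<open>E l\<close> brings the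
      commutator into the form treated by \<open>prod\<close>.\<close>
    also have "\<dots> = Y ** dual_adj u ** mat 1 - mat 1 ** dual_adj u ** Y"
      using prod[of y "\<lambda>_. 1"] prod[of "\<lambda>_. 1" y]
      by (simp add: sum_E Y_def sum_subtractf scaleR_left_diff_distrib)
    finally have "(distance_matrix adj i ** dual_adj u ** distance_matrix adj j) $ v $ w
        - (distance_matrix adj j ** dual_adj u ** distance_matrix adj i) $ v $ w
        = (Y ** dual_adj u ** mat 1) $ v $ w - (mat 1 ** dual_adj u ** Y) $ v $ w"
      by (metis vector_minus_component)
    moreover have "(distance_matrix adj i ** dual_adj u ** distance_matrix adj j) $ v $ w
        = (\<Sum>z\<in>sphere_meet adj i j v w. t (d z u))" for i j
    proof -
      have "(distance_matrix adj i ** dual_adj u ** distance_matrix adj j) $ v $ w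
        = (\<Sum>z\<in>UNIV. if z \<in> sphere_meet adj i j v w then t (d z u) else 0)"
        unfolding mult_dual_adj_mult
        by (intro sum.cong refl) (auto simp: distance_matrix_def sphere_meet_def d_sym)
      then show ?thesis by (simp add: sum.If_cases)
    qed
    moreover have "(Y ** dual_adj u ** mat 1) $ v $ w = f h * t (d w u)"
      by (simp add: mult_dual_adj_mult mat_def f that if_distrib[of "(*) _"] d_sym cong: if_cong)
    moreover have "(mat 1 ** dual_adj u ** Y) $ v $ w = f h * t (d v u)"
      by (simp add: mult_dual_adj_mult mat_def f that if_distrib[of "\<lambda>x. x * _"] d_sym cong: if_cong)
    ultimately show ?thesis by (simp add: algebra_simps)
  qed
  then show ?thesis by blast
qed

end

section \<open>Arithmetic of the parameters\<close>

text \<open>This is the Chebyshev polynomial of the second kind U_j evaluated at z/2.\<close>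

fun chebU :: "real \<Rightarrow> nat \<Rightarrow> real" where
  "chebU z 0 = 1"
| "chebU z (Suc 0) = z"
| "chebU z (Suc (Suc j)) = z * chebU z (Suc j) - chebU z j"

text \<open>The quadratic form is an invariant of the recurrence and keeps its value at
  \<open>j = 0\<close>.\<close>

lemma chebU_casorati: "(chebU z (Suc j))\<^sup>2 - z * chebU z (Suc j) * chebU z j + (chebU z j)\<^sup>2 = 1"
proof (induction j)
  case 0
  then show ?case by (simp add: power2_eq_square)
next
  case (Suc j)
  have "(chebU z (Suc (Suc j)))\<^sup>2 - z * chebU z (Suc (Suc j)) * chebU z (Suc j) + (chebU z (Suc j))\<^sup>2
      = (chebU z (Suc j))\<^sup>2 - z * chebU z (Suc j) * chebU z j + (chebU z j)\<^sup>2"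
    by (simp add: power2_eq_square algebra_simps)
  then show ?case using Suc by simp
qed

lemma chebU_pos_incr:
  assumes "z > 2"
  shows "chebU z j > 0 \<and> chebU z (Suc j) > chebU z j"
proof (induction j)
  case (Suc j)
  then have "2 * chebU z (Suc j) < z * chebU z (Suc j)" using assms by simp
  then show ?case using Suc by (simp only: chebU.simps) linarith
qed (use assms in simp)

text \<open>For \<open>z > 2\<close> the differences increase, so the bound is the first one, U_2 -
  U_1. Diameter at least 5 leads to U_(D-3) - U_(D-4), which is in this range.\<close>

lemma chebU_diff_ge:
  assumes "z > 2"
  shows "z\<^sup>2 - z - 1 \<le> chebU z (Suc (Suc j)) - chebU z (Suc j)"
proof (induction j)
  case (Suc j)
  have "2 * chebU z (Suc (Suc j)) < z * chebU z (Suc (Suc j))"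
    using assms chebU_pos_incr[OF assms, of "Suc (Suc j)"] by (intro mult_strict_right_mono) auto
  then show ?case using Suc unfolding chebU.simps(3)[of z "Suc j"] by linarith
qed (simp add: power2_eq_square)

text \<open>The cubic links the eigenvalue \<open>s\<close> to \<open>m = k - 1\<close> and \<open>c = c\<^sub>3\<close>; \<open>y\<^sub>i\<close> stands for the
  difference of the dual eigenvalues at distances \<open>i\<close> and \<open>i + 1\<close>.\<close>

lemma eigenvalue_cubic:
  fixes y0 y1 y2 m c s r :: real
  assumes e1: "(s + 1) * y0 = m * y1" and e2: "s * y1 = y0 + m * y2"
    and e3: "r * y1 = y0 + y1 + y2" and e4: "r * (y0 + (c - 1) * y2) = c * y1"
    and nz: "y0 \<noteq> 0" "y0 + y1 \<noteq> 0" "m \<noteq> 0"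
  shows "(c - 1) * (m\<^sup>2 + m * s - s\<^sup>2 - s^3) = m\<^sup>2 * (m - 1)"
    and "m * (s + 1) * r = s\<^sup>2 + (m + 1) * s + m\<^sup>2"
proof -
  have y1: "y1 = (s + 1) * y0 / m" using e1 nz by (simp add: field_simps)
  have y2: "y2 = (s\<^sup>2 + s - m) * y0 / m\<^sup>2"
    using e2 nz by (simp add: y1 field_simps power2_eq_square)
  \<comment> \<open>\<open>r\<close> is eliminated between \<open>e3\<close> and
    \<open>e4\<close>.\<close>
  have "(y0 + (c - 1) * y2) * (y0 + y1 + y2) = r * y1 * (y0 + (c - 1) * y2)"
    using e3 by simp
  also have "\<dots> = c * y1\<^sup>2" using e4 by algebra
  finally have fin: "(y0 + (c - 1) * y2) * (y0 + y1 + y2) = c * y1\<^sup>2" .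
  have "(m\<^sup>2 * y0 + (c - 1) * (m\<^sup>2 * y2)) * (m\<^sup>2 * y0 + m * (m * y1) + m\<^sup>2 * y2) = c * m\<^sup>2 * (m * y1)\<^sup>2"
    using fin by algebra
  moreover have "m * y1 = (s + 1) * y0" "m\<^sup>2 * y2 = (s\<^sup>2 + s - m) * y0"
    using nz by (simp_all add: y1 y2)
  ultimately have "y0\<^sup>2 * ((m\<^sup>2 + (c - 1) * (s\<^sup>2 + s - m)) * (m\<^sup>2 + m * (s + 1) + (s\<^sup>2 + s - m)))
      = y0\<^sup>2 * (c * m\<^sup>2 * (s + 1)\<^sup>2)"
    by algebra
  then have "(m\<^sup>2 + (c - 1) * (s\<^sup>2 + s - m)) * (m\<^sup>2 + m * (s + 1) + (s\<^sup>2 + s - m)) = c * m\<^sup>2 * (s + 1)\<^sup>2"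
    using nz by simp
  then have "(s + m + 1) * ((c - 1) * (m\<^sup>2 + m * s - s\<^sup>2 - s^3) - m\<^sup>2 * (m - 1)) = 0"
    by algebra
  \<comment> \<open>The spurious factor would give \<open>y0 + y1 = 0\<close>, that is, equal dual
    eigenvalues at distances 0 and 2.\<close>
  moreover have "s + m + 1 \<noteq> 0"
  proof
    assume "s + m + 1 = 0"
    then have "m * (y0 + y1) = 0" using e1 by algebra
    then show False using nz by simp
  qed
  ultimately show "(c - 1) * (m\<^sup>2 + m * s - s\<^sup>2 - s^3) = m\<^sup>2 * (m - 1)" by simp
  have "m\<^sup>2 * (r * y1) = m\<^sup>2 * (y0 + y1 + y2)" using e3 by simp
  then have "y0 * (m * (s + 1) * r) = y0 * (s\<^sup>2 + (m + 1) * s + m\<^sup>2)"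
    using \<open>m * y1 = _\<close> \<open>m\<^sup>2 * y2 = _\<close> by algebra
  then show "m * (s + 1) * r = s\<^sup>2 + (m + 1) * s + m\<^sup>2" using nz by simp
qed

text \<open>With \<open>e = m - c\<close> the cubic forces \<open>4 * e\<^sup>2 < m\<close>, whereas \<open>m - 1\<close> divides \<open>e * (e + 1)\<close>.\<close>

lemma cubic_positive_root_impossible:
  fixes m c :: nat and s :: real
  assumes cubic: "(real c - 1) * ((real m)\<^sup>2 + m * s - s\<^sup>2 - s^3) = real m ^ 2 * (real m - 1)"
    and s: "0 < s" and c: "2 \<le> c" "c < m" and dv: "(m - 1) dvd (c - 1) * (c - 2)"
  shows False
proof -
  define e where "e = m - c"
  have e: "1 \<le> e" "c = m - e" "e < m" using c by (auto simp: e_def)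
  have er: "real c = real m - real e" using e by simp
  have eq: "real m ^ 2 * e = (real c - 1) * (s * (m - s - s\<^sup>2))"
    using cubic unfolding er by algebra
  have mp: "real m > 0" "real c - 1 > 0" using c by auto
  have "0 < real m ^ 2 * e" using mp e by simp
  then have pos: "0 < s * (m - s - s\<^sup>2)" unfolding eq using mp zero_less_mult_pos by blast
  then have q: "m - s - s\<^sup>2 > 0" using s zero_less_mult_pos by blast
  have "real m * (m * e) \<le> real m * (s * (m - s - s\<^sup>2))"
  proof -
    have "real m * (m * e) = (real c - 1) * (s * (m - s - s\<^sup>2))" using eq by (simp add: power2_eq_square)
    also have "\<dots> \<le> m * (s * (m - s - s\<^sup>2))" using pos c by (intro mult_right_mono) auto
    finally show ?thesis .
  qed
  then have "m * real e \<le> s * (m - s - s\<^sup>2)" using mp by simp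
  also have "\<dots> < s * (m - s\<^sup>2)" using s by simp
  finally have "(m * real e)\<^sup>2 < (s * (m - s\<^sup>2))\<^sup>2" by (intro power_strict_mono) auto
  also have "\<dots> = (s\<^sup>2 * (m - s\<^sup>2)) * (m - s\<^sup>2)" by (simp add: power2_eq_square)
  \<comment> \<open>The inequality of arithmetic and geometric means bounds the first
    factor.\<close>
  also have "\<dots> \<le> (real m ^ 2 / 4) * m"
  proof (rule mult_mono)
    have "0 \<le> (real m / 2 - s\<^sup>2)\<^sup>2" by simp
    then show "s\<^sup>2 * (m - s\<^sup>2) \<le> real m ^ 2 / 4" by (simp add: power2_eq_square algebra_simps)
  qed (use q s in auto)
  finally have "real m ^ 2 * (4 * real e ^ 2) < real m ^ 2 * m" by (simp add: power_mult_distrib)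
  then have "4 * real e ^ 2 < m" using mp by simp
  then have "real (4 * e ^ 2) < real m" by simp
  then have e4: "4 * e ^ 2 < m" by (simp only: of_nat_less_iff)
  have "int (m - 1) dvd int ((c - 1) * (c - 2))" using dv by (simp only: of_nat_dvd_iff)
  then have "int m - 1 dvd (int c - 1) * (int c - 2)" using c by (simp add: of_nat_diff)
  \<comment> \<open>Modulo m - 1, the factors c - 1 and c - 2 are -e and -(e + 1), because c = m -
    e.\<close>
  moreover have "(int c - 1) * (int c - 2) = int e * (int e + 1) + (int m - 1) * (int m - 2 - 2 * int e)"
    using e by (simp add: of_nat_diff algebra_simps)
  ultimately have "int m - 1 dvd int e * (int e + 1)" by (metis dvd_add_left_iff dvd_triv_left)
  then have "int m - 1 \<le> int e * (int e + 1)" using e by (intro zdvd_imp_le) auto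
  then have "int m - 1 \<le> int (e * (e + 1))" by (simp add: algebra_simps)
  then have "m \<le> e * (e + 1) + 1" by linarith
  moreover have "e \<le> e ^ 2" using e by (simp add: power2_eq_square)
  moreover have "1 \<le> e ^ 2" using e by simp
  moreover have "e * (e + 1) = e ^ 2 + e" by (simp add: power2_eq_square)
  ultimately show False using e4 by linarith
qed

text \<open>At \<open>s = -m\<close>, the value for the Odd graph, the second factor on the left is
  m^2 (m - 1), which matches \<open>c = 2\<close>. Subtracting that value splits off
  \<open>- s - m\<close>, with a cofactor that is positive for \<open>s < -1\<close>.\<close>

lemma cubic_negative_root:
  fixes m c s :: real
  assumes cubic: "(c - 1) * (m\<^sup>2 + m * s - s\<^sup>2 - s^3) = m\<^sup>2 * (m - 1)"
    and s: "s < -1" and c: "2 \<le> c" and m: "2 \<le> m"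
  shows "- m \<le> s" and "c = 2 \<Longrightarrow> s = - m"
proof -
  let ?P = "m\<^sup>2 + m * s - s\<^sup>2 - s^3"
  have fac: "?P - m\<^sup>2 * (m - 1) = (- s - m) * ((s\<^sup>2 + s) + m * (m - s - 2))" by algebra
  have "s\<^sup>2 + s = s * (s + 1)" by (simp add: power2_eq_square algebra_simps)
  also have "\<dots> > 0" using s by (intro mult_neg_neg) auto
  finally have "(s\<^sup>2 + s) + m * (m - s - 2) > 0" using s m by (simp add: add_pos_pos)
  note pos = this
  show "- m \<le> s"
  proof (rule ccontr)
    assume "\<not> - m \<le> s"
    then have "?P - m\<^sup>2 * (m - 1) > 0" unfolding fac using pos by simp
    moreover have "m\<^sup>2 * (m - 1) > 0" using m by simp
    ultimately have "?P > m\<^sup>2 * (m - 1)" "?P > 0" by auto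
    moreover have "(c - 1) * ?P \<ge> 1 * ?P" using c \<open>?P > 0\<close> by (intro mult_right_mono) auto
    ultimately show False using cubic by simp
  qed
  show "s = - m" if "c = 2"
    using cubic fac pos that by simp
qed

text \<open>For diameter 3 this is the condition that c_3 divides k (k - 1)^2, written in z. Modulo
  z^2 - 2 the dividend reduces to 10 - 7 z, which bounds z and leaves four values to check.\<close>

lemma no_integer_parameter:
  fixes z :: int
  assumes "3 \<le> z"
    and "(z - 1) * (z\<^sup>2 - 2) dvd ((z\<^sup>2 - 1) * (z\<^sup>2 - z - 1) + 1) * ((z\<^sup>2 - 1) * (z\<^sup>2 - z - 1))\<^sup>2"
  shows False
proof -
  define w where "w = z\<^sup>2 - 2"
  define m where "m = (z\<^sup>2 - 1) * (z\<^sup>2 - z - 1)"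
  have m: "m = w * (w + 2 - z) + (1 - z)" unfolding m_def w_def by algebra
  have "w dvd (m + 1) * m\<^sup>2"
    using assms(2) unfolding m_def w_def using dvd_mult_right by blast
  moreover have "\<exists>u. (m + 1) * m\<^sup>2 = w * u + (10 - 7 * z)"
  proof -
    define u where "u = w + 2 - z"
    have "(m + 1) * m\<^sup>2 = (w * u + (2 - z)) * (w * u + (1 - z))\<^sup>2" unfolding m u_def by simp
    also have "\<dots> = w * (u * (w * u + (1 - z))\<^sup>2 + (2 - z) * (w * u\<^sup>2 + 2 * u * (1 - z))) + (2 - z) * (1 - z)\<^sup>2"
      by algebra
    also have "(2 - z) * (1 - z)\<^sup>2 = w * (4 - z) + (10 - 7 * z)" unfolding w_def by algebra
    finally show ?thesis by (metis add.assoc distrib_left)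
  qed
  ultimately have "w dvd 10 - 7 * z" by (metis dvd_add_right_iff dvd_triv_left)
  then have dv: "w dvd 7 * z - 10" by (metis dvd_minus_iff minus_diff_eq)
  then have "w \<le> 7 * z - 10" using assms(1) by (intro zdvd_imp_le) auto
  then have "z * (z - 7) \<le> -8" unfolding w_def by (simp add: power2_eq_square algebra_simps)
  then have "z < 7" using assms(1) mult_nonneg_nonneg[of z "z - 7"] by linarith
  then have "z = 3 \<or> z = 4 \<or> z = 5 \<or> z = 6" using assms(1) by auto
  then show False using dv by (auto simp: w_def)
qed

text \<open>\<open>v * a\<close>, \<open>v * b\<close> are the alternating differences at positions 2 and 3; the recurrence
  determines those at positions 0 and 1, and \<open>m\<close>, \<open>c\<close>, \<open>s\<close> with them.\<close>

lemma chebyshev_parameters: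
  fixes a b z s m c l :: real
  defines "A \<equiv> (z\<^sup>2 - 1) * a - z * b" and "B \<equiv> z * a - b"
  assumes cas: "a\<^sup>2 - z * a * b + b\<^sup>2 = 1"
    and e1: "(s + 1) * A = - m * B" and e2: "- s * B = A + m * a"
    and e4: "(1 - z) * (A + (c - 1) * a) = - c * B"
    and l: "l * (m - 1) = (c - 1) * (c - 2)" and m: "m > 1"
  shows "m = A * (A - B)" and "c * (a - b) = (z - 1) * (A - a)"
    and "(c - 2) * (a - b) = (z + 1) * (z - 2) * B"
    and "l * (a - b)\<^sup>2 = (z + 1) * (z - 2)"
proof -
  \<comment> \<open>As A = z B - a, this is the same invariant form at the next pair (B, a).\<close>
  have BA: "B\<^sup>2 - A * a = 1" using cas unfolding A_def B_def by algebra
  have "A * B = A\<^sup>2 - m * (B\<^sup>2 - A * a)" using e1 e2 by algebra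
  then show m_eq: "m = A * (A - B)" unfolding BA by (simp add: power2_eq_square algebra_simps)
  show c_eq: "c * (a - b) = (z - 1) * (A - a)" using e4 unfolding A_def B_def by algebra
  show c2: "(c - 2) * (a - b) = (z + 1) * (z - 2) * B" using c_eq unfolding A_def B_def by algebra
  have c1: "(c - 1) * (a - b) * B = m - 1"
  proof -
    have "(c - 1) * (a - b) * B = ((z - 1) * (A - a) - (a - b)) * B" using c_eq by algebra
    also have "\<dots> = A\<^sup>2 - A * B - (a\<^sup>2 - z * a * b + b\<^sup>2)" unfolding A_def B_def by algebra
    finally show ?thesis unfolding cas m_eq by (simp add: power2_eq_square algebra_simps)
  qed
  \<comment> \<open>The design equation is multiplied by (a - b)^2; the factor m - 1 then cancels
    and a relation between \<open>l\<close> and \<open>z\<close> remains.\<close>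
  have "(m - 1) * (l * (a - b)\<^sup>2) = ((c - 1) * (a - b)) * ((c - 2) * (a - b))"
    using l by algebra
  also have "\<dots> = ((c - 1) * (a - b) * B) * ((z + 1) * (z - 2))" unfolding c2 by simp
  also have "\<dots> = (m - 1) * ((z + 1) * (z - 2))" unfolding c1 by simp
  finally show "l * (a - b)\<^sup>2 = (z + 1) * (z - 2)" using m by simp
qed

text \<open>Three consecutive differences add up to \<open>r\<close> times the middle one. With
  alternating signs and read backwards from \<open>D\<close>, this is the Chebyshev recurrence at
  \<open>1 - r\<close>. The equation \<open>recD\<close> says that the difference just beyond
  \<open>D\<close> counts as zero, in the role of U_(-1).\<close>

lemma alternating_differences:
  fixes t :: "nat \<Rightarrow> real"
  assumes D: "2 \<le> D"
    and rec: "\<And>a. a + 3 \<le> D \<Longrightarrow> t a - t (a + 3) = r * (t (a + 1) - t (a + 2))"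
    and recD: "t (D - 2) - t D = r * (t (D - 1) - t D)"
    and "n < D"
  shows "(-1) ^ n * (t n - t (Suc n)) =
    (-1) ^ (D - 1) * (t (D - 1) - t (Suc (D - 1))) * chebU (1 - r) (D - 1 - n)"
proof -
  define Y where "Y i = t i - t (Suc i)" for i
  define v where "v = (-1) ^ (D - 1) * Y (D - 1)"
  define z where "z = 1 - r"
  have Yrec: "Y a + Y (a + 2) = - z * Y (a + 1)" if "a + 3 \<le> D" for a
    using rec[OF that] unfolding Y_def z_def by (simp add: algebra_simps numeral_eq_Suc)
  have W: "(-1) ^ (D - 1 - j) * Y (D - 1 - j) = v * chebU z j" if "j < D" for j
    using that
  proof (induction j rule: less_induct)
    case (less j)
    consider "j = 0" | "j = 1" | i where "j = Suc (Suc i)"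
      by (metis One_nat_def not0_implies_Suc)
    then show ?case
    proof cases
      case 1 then show ?thesis by (simp add: v_def)
    next
      case 2
      obtain n where n: "D = Suc (Suc n)" using D that[of "D - 2"] by simp
      have "Y n + Y (Suc n) = r * Y (Suc n)" using recD unfolding n Y_def by simp
      then have "Y n = - z * Y (Suc n)" unfolding z_def by (simp add: algebra_simps)
      then show ?thesis using 2 n by (simp add: v_def)
    next
      case 3
      define n where "n = D - 1 - j"
      have n: "D - 1 - Suc i = n + 1" "D - 1 - i = n + 2" "n + 3 \<le> D" "D - 1 - j = n"
        using less.prems 3 by (auto simp: n_def)
      have "(-1) ^ (n + 1) * Y (n + 1) = v * chebU z (Suc i)"
        using less.IH[of "Suc i"] less.prems 3 n by simp
      moreover have "(-1) ^ (n + 2) * Y (n + 2) = v * chebU z i"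
        using less.IH[of i] less.prems 3 n by simp
      moreover have "(-1) ^ n * Y n = z * ((-1) ^ (n + 1) * Y (n + 1)) - (-1) ^ (n + 2) * Y (n + 2)"
      proof -
        have Y_n: "Y n = - z * Y (n + 1) - Y (n + 2)" using Yrec[OF n(3)] by simp
        show ?thesis unfolding Y_n by (simp add: algebra_simps)
      qed
      ultimately have "(-1) ^ n * Y n = v * chebU z j" unfolding 3 by (simp add: algebra_simps)
      then show ?thesis unfolding n(4) .
    qed
  qed
  show ?thesis using W[of "D - 1 - n"] \<open>n < D\<close> by (simp add: v_def Y_def z_def)
qed

text \<open>The discriminant of the quadratic is 4 l + 9. Integrality of l z makes it the square of
  an integer, necessarily odd, so z is an integer.\<close>

lemma odd_square_root_rational:
  fixes l p :: int and z :: real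
  assumes "l > 0" and "p = l * z" and "z * z - z = l + 2"
  shows "\<exists>w :: int. z = w"
proof -
  have "real_of_int ((2 * p - l) ^ 2) = real_of_int (l ^ 2 * (4 * l + 9))"
  proof -
    have "real_of_int ((2 * p - l) ^ 2) = l ^ 2 * (4 * (z * z - z) + 1)"
      using assms(2) by (simp add: power2_eq_square algebra_simps)
    then show ?thesis unfolding assms(3) by simp
  qed
  then have sq: "(2 * p - l) ^ 2 = l ^ 2 * (4 * l + 9)" by (simp only: of_int_eq_iff)
  then have "l ^ 2 dvd (2 * p - l) ^ 2" by simp
  then have "l dvd 2 * p - l" by (simp add: pow_divides_pow_iff)
  then obtain j where j: "2 * p - l = l * j" by blast
  have "l\<^sup>2 * j\<^sup>2 = l\<^sup>2 * (4 * l + 9)" using sq unfolding j by (simp add: power_mult_distrib)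
  then have "j\<^sup>2 = 4 * l + 9" using assms(1) by simp
  then have "odd (j\<^sup>2)" by simp
  then have "odd j" by simp
  then obtain w where w: "j = 2 * w + 1" by (rule oddE)
  have "real_of_int (2 * p - l) = real_of_int (l * j)" using j by simp
  then have "l * (2 * z - 1) = l * real_of_int j" using assms(2) by (simp add: algebra_simps)
  then have "2 * z - 1 = j" using assms(1) by simp
  then have "z = w + 1" using w by simp
  then show ?thesis by (metis of_int_1 of_int_add)
qed

text \<open>Here \<open>m = k - 1\<close> and \<open>c = c3\<close>. The assumptions
  \<open>div3\<close> and \<open>div4\<close> express the integrality of the third and fourth shell
  sizes; for \<open>D = 4\<close> the eigenvalue equation in the last shell ties \<open>c4\<close>
  to \<open>t\<close>.\<close>

lemma dual_eigenvalue_arithmetic: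
  fixes t :: "nat \<Rightarrow> real" and D m c :: nat and s r :: real
  assumes D3: "3 \<le> D" and inj: "inj_on t {..D}"
    and rec: "\<And>a. a + 3 \<le> D \<Longrightarrow> t a - t (a + 3) = r * (t (a + 1) - t (a + 2))"
    and recD: "t (D - 2) - t D = r * (t (D - 1) - t D)"
    and ev0: "s * t 0 = (m + 1) * t 1" and ev1: "t 0 + m * t 2 = s * t 1"
    and ev2: "t 1 + m * t 3 = s * t 2"
    and e4: "r * (t 0 - t 1 + (real c - 1) * (t 2 - t 3)) = c * (t 1 - t 2)"
    and c: "2 \<le> c" "c \<le> m" and design: "(m - 1) dvd (c - 1) * (c - 2)"
    and div3: "D = 3 \<Longrightarrow> c dvd (m + 1) * m\<^sup>2"
    and div4: "D = 4 \<Longrightarrow> \<exists>(n :: nat) (c4 :: nat). real c4 * (t 3 - t 4) = (s - (m + 1)) * t 4 \<and>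
        n * c4 * c = (m + 1) * m\<^sup>2 * (m + 1 - c)"
  shows "s = - real m" and "r = -1"
proof -
  have ne: "t i \<noteq> t j" if "i \<le> D" "j \<le> D" "i \<noteq> j" for i j
    using inj that by (auto simp: inj_on_def)
  define Y where "Y i = t i - t (Suc i)" for i
  have Y_sum: "Y 0 = t 0 - t 1" "Y 1 = t 1 - t 2" "Y 2 = t 2 - t 3"
    by (simp_all add: Y_def numeral_2_eq_2 numeral_3_eq_3)
  have m2: "2 \<le> m" using c by simp
  have y1: "(s + 1) * Y 0 = m * Y 1" using ev0 ev1 unfolding Y_sum by (simp add: algebra_simps)
  have y2: "s * Y 1 = Y 0 + m * Y 2" using ev1 ev2 unfolding Y_sum by (simp add: algebra_simps)
  have y3: "r * Y 1 = Y 0 + Y 1 + Y 2"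
    using rec[of 0] D3 unfolding Y_sum by (simp add: eval_nat_numeral)
  have y4: "r * (Y 0 + (real c - 1) * Y 2) = c * Y 1" using e4 unfolding Y_sum by simp
  have Y_nz: "Y i \<noteq> 0" if "i < D" for i using ne[of i "Suc i"] that by (simp add: Y_def)
  have nz: "Y 0 \<noteq> 0" "Y 0 + Y 1 \<noteq> 0" "Y 1 \<noteq> 0" "Y 2 \<noteq> 0" "Y 1 + Y 2 \<noteq> 0"
    using ne[of 0 1] ne[of 0 2] ne[of 1 2] ne[of 2 3] ne[of 1 3] D3 unfolding Y_sum by auto
  have cubic: "(real c - 1) * ((real m)\<^sup>2 + m * s - s\<^sup>2 - s^3) = real m ^ 2 * (real m - 1)"
    and r_eq: "m * (s + 1) * r = s\<^sup>2 + (real m + 1) * s + (real m)\<^sup>2"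
    using eigenvalue_cubic[OF y1 y2 y3 y4 nz(1,2)] m2 by auto
  have H: "(real m)\<^sup>2 * Y 2 = (s\<^sup>2 + s - m) * Y 0" using y1 y2 by algebra
  have "s \<noteq> 0"
  proof
    assume "s = 0"
    then have "m * (Y 1 + Y 2) = 0" using y1 y2 by (simp add: algebra_simps)
    then show False using nz m2 by simp
  qed
  moreover have "s\<^sup>2 + s - m \<noteq> 0" using H nz m2 by auto
  ultimately have hs: "s * (s\<^sup>2 + s - m) \<noteq> 0" by simp
  have cub2: "(real c - 1) * (s * (s\<^sup>2 + s - m)) = real m ^ 2 * (real c - real m)" using cubic by algebra
  have cm: "c < m"
  proof (rule ccontr)
    assume "\<not> c < m" then have "c = m" using c by simp
    then show False using cub2 hs c by simp
  qed
  \<comment> \<open>This sign leaves only the ranges \<open>0 < s\<close> and \<open>s < -1\<close>,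
    which are treated by different arguments.\<close>
  have "(real c - 1) * (s * (s\<^sup>2 + s - m)) < 0" unfolding cub2 using cm m2 by (intro mult_pos_neg) auto
  then have hneg: "s * (s\<^sup>2 + s - m) < 0" using c by (simp add: mult_less_0_iff)
  have "\<not> 0 < s" using cubic_positive_root_impossible[OF cubic _ c(1) cm design] by blast
  then have s0: "s < 0" using \<open>s \<noteq> 0\<close> by simp
  then have "s\<^sup>2 + s > m" using hneg by (simp add: mult_less_0_iff)
  then have "s * (s + 1) > 0" using m2 by (simp add: power2_eq_square algebra_simps)
  then have s1: "s < -1" using s0 by (simp add: zero_less_mult_iff)
  note neg = cubic_negative_root[OF cubic s1]
  have sm: "- real m \<le> s" using neg(1) c m2 by simp
  show s_eq: "s = - real m"
  proof (rule ccontr)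
    assume sne: "s \<noteq> - real m"
    then have sgt: "- real m < s" using sm by simp
    have c3: "3 \<le> c" using neg(2) sne c m2 by (cases "c = 2") auto
    define z where "z = 1 - r"
    \<comment> \<open>Given \<open>s < -1\<close>, the deviation of \<open>z\<close> from 2 is
      governed by that of \<open>s\<close> from \<open>- m\<close>.\<close>
    have "m * (s + 1) * (z - 2) = - ((s + m) * (s + m + 1))"
      using r_eq unfolding z_def by algebra
    also have "\<dots> < 0" using sgt by simp
    finally have z2: "z > 2"
      using s1 m2 by (auto simp: mult_less_0_iff zero_less_mult_iff)
    obtain l where l: "(c - 1) * (c - 2) = (m - 1) * l" using design by blast
    have "l \<noteq> 0"
    proof
      assume "l = 0" then show False using l c3 by simp
    qed
    then have l1: "1 \<le> l" by simp
    have "real ((c - 1) * (c - 2)) = real ((m - 1) * l)" using l by simp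
    then have lr: "real l * (real m - 1) = (real c - 1) * (real c - 2)"
      using c3 m2 by (simp add: of_nat_diff mult.commute)
    define v where "v = (-1) ^ (D - 1) * Y (D - 1)"
    have W: "(-1) ^ n * Y n = v * chebU z (D - 1 - n)" if "n < D" for n
      using alternating_differences[OF _ rec recD that] D3 by (simp add: v_def z_def Y_def)
    have v: "v \<noteq> 0" using Y_nz[of "D - 1"] D3 by (simp add: v_def)
    define a where "a = chebU z (D - 3)"
    \<comment> \<open>The value 0 stands for U_(-1), so that the Casorati identity and the formulas
      for \<open>A\<close> and \<open>B\<close> also hold for \<open>D = 3\<close>.\<close>
    define b where "b = (if D = 3 then 0 else chebU z (D - 4))"
    define A where "A = (z\<^sup>2 - 1) * a - z * b"
    define B where "B = z * a - b"
    have D_eq: "D - 3 = Suc (D - 4)" if "D \<noteq> 3" using D3 that by simp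
    have cas: "a\<^sup>2 - z * a * b + b\<^sup>2 = 1"
      using chebU_casorati[of z "D - 4"] D_eq by (cases "D = 3") (auto simp: a_def b_def)
    have D2: "D - 2 = Suc (D - 3)" "D - 1 = Suc (Suc (D - 3))" using D3 by auto
    have U: "chebU z (D - 2) = B" "chebU z (D - 1) = A"
    proof -
      show B: "chebU z (D - 2) = B"
        using D_eq unfolding D2 by (cases "D = 3") (auto simp: B_def a_def b_def)
      then show "chebU z (D - 1) = A"
        unfolding D2 chebU.simps(3) A_def B_def a_def by algebra
    qed
    have V: "Y 0 = v * A" "- Y 1 = v * B" "Y 2 = v * a"
      using W[of 0] W[of 1] W[of 2] D3 U by (simp_all add: a_def eval_nat_numeral)
    have "v * ((s + 1) * A) = v * (- real m * B)" using y1 V by algebra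
    then have f1: "(s + 1) * A = - real m * B" using mult_left_cancel[OF v] by blast
    have "v * (- s * B) = v * (A + real m * a)" using y2 V by algebra
    then have f2: "- s * B = A + real m * a" using mult_left_cancel[OF v] by blast
    have "v * ((1 - z) * (A + (real c - 1) * a)) = v * (- real c * B)" using y4 V unfolding z_def by algebra
    then have f4: "(1 - z) * (A + (real c - 1) * a) = - real c * B" using mult_left_cancel[OF v] by blast
    have m1: "real m > 1" using m2 by simp
    note par = chebyshev_parameters[OF cas f1[unfolded A_def B_def] f2[unfolded A_def B_def]
        f4[unfolded A_def B_def] lr m1, folded A_def B_def]
    consider "D = 3" | "D = 4" | "5 \<le> D" using D3 by linarith
    then show False
    proof cases
      case 1
      then have ab: "a = 1" "b = 0" by (simp_all add: a_def b_def)
      \<comment> \<open>Now l = (z + 1)(z - 2) and c - 2 = l z, so l z is an integer and z is one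
        too.\<close>
      have z_l: "z * z - z = int l + 2" using par(4) unfolding ab by (simp add: algebra_simps)
      have "real c - 2 = l * z" using par(3,4) unfolding ab by (simp add: B_def ab)
      then have "int c - 2 = real_of_int (int l) * z" by simp
      then obtain w :: int where w: "z = w"
        using odd_square_root_rational[of "int l" "int c - 2" z] z_l l1 by auto
      have "real c = (z - 1) * (z\<^sup>2 - 2)" using par(2) unfolding ab by (simp add: A_def ab)
      then have "real_of_int (int c) = real_of_int ((w - 1) * (w\<^sup>2 - 2))" by (simp add: w)
      then have cw: "int c = (w - 1) * (w\<^sup>2 - 2)" by (simp only: of_int_eq_iff)
      have "real m = (z\<^sup>2 - 1) * (z\<^sup>2 - z - 1)" using par(1) unfolding ab by (simp add: A_def B_def ab algebra_simps)
      then have "real_of_int (int m) = real_of_int ((w\<^sup>2 - 1) * (w\<^sup>2 - w - 1))" by (simp add: w)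
      then have mw: "int m = (w\<^sup>2 - 1) * (w\<^sup>2 - w - 1)" by (simp only: of_int_eq_iff)
      have "int c dvd int ((m + 1) * m\<^sup>2)" using div3[OF 1] by (simp only: of_nat_dvd_iff)
      then have "int c dvd (int m + 1) * (int m)\<^sup>2" by (simp add: distrib_right add.commute)
      then show False using no_integer_parameter[of w] z2 w unfolding cw mw by simp
    next
      case 2
      then have ab: "a = z" "b = 1" by (simp_all add: a_def b_def)
      have l_eq: "l * (z - 1)\<^sup>2 = (z + 1) * (z - 2)" using par(4) unfolding ab .
      \<comment> \<open>2 (z - 1)^2 exceeds (z + 1)(z - 2) by (z - 3/2)^2 + 7/4.\<close>
      have "l < 2"
      proof (rule ccontr)
        assume "\<not> l < 2"
        then have "2 * (z - 1)\<^sup>2 \<le> l * (z - 1)\<^sup>2" by (intro mult_right_mono) auto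
        then have "(z - 3 / 2)\<^sup>2 + 7 / 4 \<le> 0" unfolding l_eq by (simp add: power2_eq_square algebra_simps)
        then show False using zero_le_power2[of "z - 3 / 2"] by linarith
      qed
      then have "l = 1" using l1 by simp
      then have z3: "z = 3" using l_eq by (simp add: power2_eq_square algebra_simps)
      have AB: "A = 21" "B = 8" by (simp_all add: A_def B_def ab z3)
      have "real m = 273" using par(1) unfolding AB by simp
      then have m273: "m = 273" by simp
      have "real c = 18" using par(2) unfolding ab z3 AB by simp
      then have c18: "c = 18" by simp
      have s105: "s = -105" using f1 unfolding AB m273 by simp
      have Y3: "- Y 3 = v" using W[of 3] 2 by simp
      have "t 3 - t 4 = - v" using Y3 by (simp add: Y_def eval_nat_numeral)
      moreover have "t 0 - t 4 = 15 * v" using V Y3 unfolding AB ab z3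
        by (simp add: Y_def eval_nat_numeral)
      moreover have "t 0 - t 1 = 21 * v" using V unfolding AB by (simp add: Y_def)
      ultimately have t4: "t 3 - t 4 = - v" "379 * t 4 = 69 * v" using ev0 unfolding s105 m273 by auto
      obtain n c4 :: nat where c4: "real c4 * (t 3 - t 4) = (s - (m + 1)) * t 4"
        "n * c4 * c = (m + 1) * m\<^sup>2 * (m + 1 - c)" using div4[OF 2] by blast
      have "c4 * v = 69 * v" using c4(1) t4 unfolding s105 m273 by simp
      then have "c4 = 69" using v by simp
      then have "n * 69 * 18 = 274 * 273\<^sup>2 * 256" using c4(2) unfolding m273 c18 by simp
      \<comment> \<open>The prime 23 divides 69 but none of 274, 273 and 256.\<close>
      then show False by (simp add: power2_eq_square) presburger
    next
      case 3
      then obtain j where j: "D = Suc (Suc (Suc (Suc (Suc j))))"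
        by (auto simp: le_iff_add eval_nat_numeral)
      \<comment> \<open>Since z^2 - z - 1 > 1, its square is larger than z^2 - z - 2 = (z + 1)(z -
        2), contrary to \<open>par(4)\<close> with \<open>l\<close> at least 1.\<close>
      have "z\<^sup>2 - z - 1 \<le> a - b"
        using chebU_diff_ge[OF z2, of j] by (simp add: a_def b_def j)
      moreover have z1: "1 < z\<^sup>2 - z - 1"
      proof -
        have "0 < (z - 2) * (z + 1)" using z2 by simp
        then show ?thesis by (simp add: power2_eq_square algebra_simps)
      qed
      ultimately have "(z\<^sup>2 - z - 1) * (z\<^sup>2 - z - 1) \<le> (a - b) * (a - b)" by (intro mult_mono) auto
      moreover have "1 * (z\<^sup>2 - z - 1) < (z\<^sup>2 - z - 1) * (z\<^sup>2 - z - 1)"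
        using z1 by (intro mult_strict_right_mono) auto
      moreover have "1 * (a - b)\<^sup>2 \<le> l * (a - b)\<^sup>2" using l1 by (intro mult_right_mono) auto
      ultimately show False using par(4) by (simp add: power2_eq_square algebra_simps)
    qed
  qed
  have "m * (s + 1) * (r + 1) = (s + m) * (s + m + 1)"
    using r_eq by algebra
  then show "r = -1" using s_eq s1 m2 by simp
qed

section \<open>Almost bipartite graphs of girth 6\<close>

locale almost_bip = drg adj for adj :: "'v::finite \<Rightarrow> 'v \<Rightarrow> bool" +
  fixes k :: nat
  assumes D_ge_3: "3 \<le> D" and valency: "has_valency adj k" and k_ge_3: "3 \<le> k"
    and girth_6: "girth adj = 6" and ab: "almost_bipartite adj"
begin

lemma card_nbhd: "card (nbhd x) = k"
  using valency by (simp add: has_valency_def nbhd_def)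

lemma adj_d: "adj x y \<Longrightarrow> d x y = Suc 0" "adj x y \<Longrightarrow> d y x = Suc 0"
  using d_eq_1_iff d_sym by (metis One_nat_def)+

lemma nbr_dist:
  assumes xy: "d x y = Suc i" and xz: "adj x z"
  shows "d z y = i \<or> d z y = min (Suc (Suc i)) D"
proof -
  have "d z y \<noteq> Suc i" if "Suc i < D"
  proof
    assume zy: "d z y = Suc i"
    have "card (sphere_meet adj 1 (Suc i) x y) = 0"
      using card_sphere_meet[OF xy] ab that by (simp add: almost_bipartite_def)
    moreover have "z \<in> sphere_meet adj 1 (Suc i) x y"
      using xz zy d_sym by (simp add: sphere_meet_1[simplified] nbhd_iff)
    ultimately show False by auto
  qed
  moreover have "d z y \<le> Suc (Suc i)" using d_adj_le[OF adj_sym[OF xz], of y] xy by simp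
  moreover have "i \<le> d z y" using d_adj_le[OF xz, of y] xy by simp
  moreover have "d z y \<le> D" "d x y \<le> D" by (rule d_le_diam)+
  ultimately show ?thesis using xy by (cases "Suc i < D") auto
qed

lemma nbr_dist_lt:
  assumes "d x y = Suc i" "adj x z" "Suc i < D"
  shows "d z y = i \<or> d z y = Suc (Suc i)"
  using nbr_dist[OF assms(1,2)] assms(3) by auto

lemma nbrs_dist: assumes "adj x y" "adj x z" "y \<noteq> z" shows "d y z = 2"
proof -
  have "d x z = Suc 0" using assms d_eq_1_iff by simp
  then have "d y z = 0 \<or> d y z = Suc (Suc 0)" using nbr_dist_lt[of x z 0 y] assms D_ge_3 by auto
  then show ?thesis using assms by auto
qed

lemma common_nbr_unique:
  assumes "adj x z" "adj z y" "adj x w" "adj w y" "x \<noteq> y"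
  shows "z = w"
proof (rule ccontr)
  assume "z \<noteq> w"
  then have "is_cycle adj [x, z, y, w]"
    using assms adj_irrefl adj_sym by (auto simp: is_cycle_def)
  then have "girth adj \<le> enat (length [x, z, y, w])"
    unfolding girth_def by (intro Inf_lower) blast
  then show False using girth_6 by (simp add: numeral_eq_enat)
qed

text \<open>Opposite vertices of a 6-cycle are at distance 3: a_2 = 0 leaves 1 or 3, and distance 1
  would close a 4-cycle. This yields c_3 >= 2.\<close>

lemma hexagon:
  obtains x y z w where "d x y = 3" "adj x z" "adj x w" "z \<noteq> w" "d z y = 2" "d w y = 2"
proof -
  let ?L = "{enat (length xs) | xs. is_cycle adj xs}"
  have "?L \<noteq> {}"
  proof
    assume "?L = {}"
    then have "girth adj = \<infinity>" unfolding girth_def Inf_enat_def by (rule if_P)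
    then show False using girth_6 by simp
  qed
  moreover from this obtain n where "n \<in> ?L" by blast
  then have "(LEAST n. n \<in> ?L) \<in> ?L" by (rule LeastI)
  ultimately have "Inf ?L \<in> ?L" unfolding Inf_enat_def by (simp only: if_False)
  then obtain xs where xs: "is_cycle adj xs" "length xs = 6"
    using girth_6 unfolding girth_def by (auto simp: numeral_eq_enat)
  then obtain x0 x1 x2 x3 x4 x5 where e: "xs = [x0, x1, x2, x3, x4, x5]"
    by (auto simp: eval_nat_numeral length_Suc_conv)
  have a: "adj x0 x1" "adj x1 x2" "adj x2 x3" "adj x3 x4" "adj x4 x5" "adj x5 x0"
    and dist: "distinct [x0, x1, x2, x3, x4, x5]"
    using xs unfolding e is_cycle_def by auto
  have d02: "d x0 x2 = 2" "d x4 x0 = 2"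
    using nbrs_dist[of x1 x0 x2] nbrs_dist[of x5 x4 x0] a dist adj_sym by auto
  have "d x3 x0 = 1 \<or> d x3 x0 = 3"
    using nbr_dist_lt[of x2 x0 1 x3] d02 d_sym[of x0 x2] a D_ge_3 by auto
  moreover have "d x3 x0 \<noteq> 1"
  proof
    assume "d x3 x0 = 1"
    then have "adj x3 x0" using d_eq_1_iff by simp
    then show False using common_nbr_unique[of x0 x1 x2 x3] a dist adj_sym by auto
  qed
  ultimately have "d x3 x0 = 3" by simp
  then show thesis using that[of x3 x0 x2 x4] a dist adj_sym d02 d_sym by auto
qed

text \<open>For vertices at distance i > 0 the size is c_i; writing \<open>Suc\<close> on the left
  makes the set empty for \<open>x = y\<close>.\<close>

definition closer :: "'v \<Rightarrow> 'v \<Rightarrow> 'v set" where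
  "closer x y = {z \<in> nbhd x. Suc (d z y) = d x y}"

lemma closer_iff: "z \<in> closer x y \<longleftrightarrow> adj x z \<and> Suc (d z y) = d x y"
  by (simp add: closer_def nbhd_iff)

lemma closer_eq_sphere_meet: "d x y = Suc i \<Longrightarrow> closer x y = sphere_meet adj 1 i x y"
  by (auto simp: closer_def sphere_meet_1[simplified] d_sym)

lemma card_closer: "d x y = Suc i \<Longrightarrow> card (closer x y) = p (Suc i) 1 i"
  using card_sphere_meet[of x y "Suc i" 1 i] closer_eq_sphere_meet by simp

lemma closer_le: "card (closer x y) \<le> k"
  using card_mono[of "nbhd x" "closer x y"] by (auto simp: closer_def card_nbhd)

lemma sum_nbhd:
  fixes f :: "nat \<Rightarrow> real"
  assumes "d x y = Suc i"
  shows "(\<Sum>z\<in>nbhd x. f (d z y)) =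
    p (Suc i) 1 i * f i + (real k - p (Suc i) 1 i) * f (min (Suc (Suc i)) D)"
proof -
  have sub: "closer x y \<subseteq> nbhd x" by (auto simp: closer_def)
  have "(\<Sum>z\<in>nbhd x. f (d z y)) = (\<Sum>z\<in>closer x y. f (d z y)) + (\<Sum>z\<in>nbhd x - closer x y. f (d z y))"
    using sum.subset_diff[OF sub] by (simp add: add.commute)
  also have "(\<Sum>z\<in>closer x y. f (d z y)) = card (closer x y) * f i"
    using assms by (simp add: closer_iff)
  also have "(\<Sum>z\<in>nbhd x - closer x y. f (d z y)) = card (nbhd x - closer x y) * f (min (Suc (Suc i)) D)"
  proof -
    have "f (d z y) = f (min (Suc (Suc i)) D)" if "z \<in> nbhd x - closer x y" for z
      using nbr_dist[OF assms, of z] that assms by (auto simp: closer_iff nbhd_iff)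
    then show ?thesis by simp
  qed
  also have "real (card (nbhd x - closer x y)) = real k - card (closer x y)"
    using sub closer_le[of x y] by (simp add: card_Diff_subset card_nbhd of_nat_diff)
  finally show ?thesis using card_closer[OF assms] by simp
qed

lemma p_forward:
  assumes "Suc i < D"
  shows "p (Suc i) 1 (Suc (Suc i)) = k - p (Suc i) 1 i"
proof -
  obtain x y where xy: "d x y = Suc i" using dist_attained[of "Suc i"] assms by auto
  have "sphere_meet adj 1 (Suc (Suc i)) x y = nbhd x - closer x y"
    using xy by (auto simp: sphere_meet_1[simplified] closer_iff nbhd_iff d_sym[of y]
        dest: nbr_dist_lt[OF xy _ assms])
  moreover have "closer x y \<subseteq> nbhd x" by (auto simp: closer_def)
  ultimately have "card (sphere_meet adj 1 (Suc (Suc i)) x y) = k - card (closer x y)"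
    by (simp add: card_Diff_subset card_nbhd)
  then show ?thesis using card_sphere_meet[OF xy] card_closer[OF xy] by simp
qed

lemma p_1: "p (Suc 0) (Suc 0) 0 = 1"
proof -
  obtain x y where xy: "d x y = Suc 0" using dist_attained[of "Suc 0"] D_ge_3 by auto
  have "closer x y = {y}" using xy d_eq_1_iff[of x y] by (auto simp: closer_iff)
  then show ?thesis using card_closer[OF xy] by simp
qed

lemma closer_2:
  assumes "d x y = 2" obtains w where "adj x w" "adj w y" "closer x y = {w}"
proof -
  obtain w where w: "d x w = 1" "d w y = 1" using d_split[of x y 1 1] assms by auto
  then have w': "adj x w" "adj w y" using d_eq_1_iff by auto
  have "closer x y = {w}"
    using common_nbr_unique[of x w y] w' assms w d_eq_1_iff by (fastforce simp: closer_iff)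
  then show thesis using that w' by blast
qed

lemma p_2: "p 2 (Suc 0) (Suc 0) = 1"
proof -
  obtain x y where xy: "d x y = 2" using dist_attained[of 2] D_ge_3 by auto
  obtain w where "closer x y = {w}" using closer_2[OF xy] by blast
  then show ?thesis using card_closer[of x y 1] xy by (simp add: numeral_2_eq_2)
qed

definition c3 :: nat where "c3 = p 3 1 2"

lemma card_closer_3: "d x y = 3 \<Longrightarrow> card (closer x y) = c3"
  using card_closer[of x y 2] by (simp add: c3_def eval_nat_numeral)

lemma c3_ge_2: "2 \<le> c3"
proof -
  obtain x y z w where h: "d x y = 3" "adj x z" "adj x w" "z \<noteq> w" "d z y = 2" "d w y = 2"
    using hexagon .
  then have "{z, w} \<subseteq> closer x y" by (auto simp: closer_iff)
  then have "card {z, w} \<le> card (closer x y)" by (intro card_mono) auto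
  then show ?thesis using h card_closer_3[OF h(1)] by simp
qed

lemma diam_edge: obtains u y y' where "d u y = D" "d u y' = D" "adj y y'"
proof -
  obtain y u where yu: "d y u = D" using diam_attained .
  have "card (sphere_meet adj 1 D y u) \<noteq> 0"
    using card_sphere_meet[OF yu] ab by (simp add: almost_bipartite_def)
  then obtain y' where "y' \<in> sphere_meet adj 1 D y u" by (metis card.empty ex_in_conv)
  then show thesis using that[of u y y'] yu by (auto simp: sphere_meet_1[simplified] nbhd_iff d_sym)
qed

text \<open>Some neighbour of \<open>x\<close> must fail to be closer to \<open>y\<close>. For
  \<open>D = 3\<close> an edge inside the last shell provides it, otherwise a vertex at distance
  4.\<close>

lemma c3_lt_k: "c3 < k"
proof -
  obtain x y z where xyz: "d x y = 3" "adj x z" "3 \<le> d z y"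
  proof (cases "D = 3")
    case True
    then show thesis using diam_edge that d_sym by (metis order_refl)
  next
    case False
    then obtain u y where "d u y = 1 + 3" using dist_attained[of 4] D_ge_3 by auto
    then obtain x where "d u x = 1" "d x y = 3" "d u y = 4" using d_split[of u y 1 3] by auto
    then show thesis using that[of x y u] d_eq_1_iff[of u x] adj_sym by auto
  qed
  then have "z \<in> nbhd x" "z \<notin> closer x y" by (auto simp: closer_iff nbhd_iff)
  moreover have "closer x y \<subseteq> nbhd x" by (auto simp: closer_def)
  ultimately have "closer x y \<subset> nbhd x" by blast
  then have "card (closer x y) < card (nbhd x)" by (intro psubset_card_mono) auto
  then show ?thesis using card_closer_3[OF xyz(1)] card_nbhd by simp
qed

lemma shell_counts:
  obtains n3 where "n3 * c3 = k * (k - 1)\<^sup>2"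
    "D \<ge> 4 \<Longrightarrow> \<exists>n4. n4 * p 4 1 3 = n3 * (k - c3)"
proof -
  fix x :: 'v
  have "shell 1 x = nbhd x" by (auto simp: shell_def nbhd_def d_eq_1_iff[simplified])
  then have n1: "card (shell 1 x) = k" by (simp add: card_nbhd)
  have "card (shell 1 x) * p 1 1 2 = card (shell 2 x) * p 2 1 1"
    using shell_edge_count[of 1 x] by (simp add: numeral_2_eq_2)
  moreover have "p 1 1 2 = k - 1"
    using p_forward[of 0] p_1 D_ge_3 by (simp add: numeral_2_eq_2)
  ultimately have n2: "card (shell 2 x) = k * (k - 1)" using n1 p_2 by simp
  have "card (shell 2 x) * p 2 1 3 = card (shell 3 x) * p 3 1 2"
    using shell_edge_count[of 2 x] by (simp add: eval_nat_numeral)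
  moreover have "p 2 1 3 = k - 1"
    using p_forward[of 1] p_2 D_ge_3 by (simp add: eval_nat_numeral)
  ultimately have n3: "card (shell 3 x) * c3 = k * (k - 1)\<^sup>2"
    using n2 by (simp add: c3_def power2_eq_square)
  have "card (shell 4 x) * p 4 1 3 = card (shell 3 x) * (k - c3)" if "4 \<le> D"
  proof -
    have "card (shell 3 x) * p 3 1 4 = card (shell 4 x) * p 4 1 3"
      using shell_edge_count[of 3 x] by (simp add: eval_nat_numeral)
    moreover have "p 3 1 4 = k - c3"
      using p_forward[of 2] that by (simp add: eval_nat_numeral c3_def)
    ultimately show ?thesis by simp
  qed
  then show thesis using that[OF n3] by blast
qed

end

section \<open>Dual eigenvalues\<close>

text \<open>What the remaining argument takes from \<open>E 1\<close>: its entries as a sequence,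
  the eigenvalue \<open>s\<close>, and the constant \<open>K\<close> of the balanced set condition
  at distance 3.\<close>

locale dual_sequence = almost_bip adj k for adj :: "'v::finite \<Rightarrow> 'v \<Rightarrow> bool" and k +
  fixes t :: "nat \<Rightarrow> real" and s K :: real
  assumes t_inj: "inj_on t {..D}"
    and eigen: "\<And>x y. (\<Sum>z\<in>nbhd x. t (d z y)) = s * t (d x y)"
    and balanced: "\<And>x y u. d x y = 3 \<Longrightarrow>
      (\<Sum>z\<in>sphere_meet adj 1 2 x y. t (d z u)) - (\<Sum>z\<in>sphere_meet adj 2 1 x y. t (d z u))
        = K * (t (d x u) - t (d y u))"
    and t_gram: "\<And>x y. (\<Sum>z\<in>UNIV. t (d x z) * t (d z y)) = t (d x y)"
    and t_0_pos: "0 < t 0"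
begin

lemma t_neq: "i \<le> D \<Longrightarrow> j \<le> D \<Longrightarrow> i \<noteq> j \<Longrightarrow> t i \<noteq> t j"
  using t_inj by (auto simp: inj_on_def)

lemma eigen_step:
  assumes "Suc i \<le> D"
  shows "p (Suc i) 1 i * t i + (real k - p (Suc i) 1 i) * t (min (Suc (Suc i)) D) = s * t (Suc i)"
proof -
  obtain x y where xy: "d x y = Suc i" using dist_attained assms by blast
  show ?thesis using sum_nbhd[OF xy, of t] eigen[of y x] xy by simp
qed

lemma eigen_0: "s * t 0 = k * t 1"
proof -
  fix x :: 'v
  have "(\<Sum>z\<in>nbhd x. t (d z x)) = (\<Sum>z\<in>nbhd x. t 1)"
    by (intro sum.cong refl) (simp add: nbhd_iff adj_d)
  then show ?thesis using eigen[of x x] by (simp add: card_nbhd)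
qed

lemma eigen_1: "t 0 + (real k - 1) * t 2 = s * t 1"
  using eigen_step[of 0] D_ge_3 p_1 by (simp add: numeral_2_eq_2)

lemma eigen_2: "t 1 + (real k - 1) * t 3 = s * t 2"
  using eigen_step[of 1] D_ge_3 p_2 by (simp add: eval_nat_numeral)

lemma balanced_closer:
  assumes "d x y = 3"
  shows "(\<Sum>z\<in>closer x y. t (d z u)) - (\<Sum>w\<in>closer y x. t (d w u)) = K * (t (d x u) - t (d y u))"
proof -
  have "closer x y = sphere_meet adj 1 2 x y"
    using closer_eq_sphere_meet[of x y 2] assms by simp
  moreover have "closer y x = sphere_meet adj 2 1 x y"
    using closer_eq_sphere_meet[of y x 2] assms d_sym by (auto simp: sphere_meet_def)
  ultimately show ?thesis using balanced[OF assms] by simp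
qed

lemma K_eq: "c3 * (t 1 - t 2) = K * (t 0 - t 3)"
proof -
  obtain x y where xy: "d x y = 3" using dist_attained[of 3] D_ge_3 by auto
  then have yx: "d y x = 3" by (simp add: d_sym)
  have "(\<Sum>z\<in>closer x y. t (d z x)) = c3 * t 1"
    by (simp add: closer_iff adj_d card_closer_3[OF xy])
  moreover have "(\<Sum>w\<in>closer y x. t (d w x)) = c3 * t 2"
    using yx by (simp add: closer_iff card_closer_3[OF yx])
  ultimately show ?thesis using balanced_closer[OF xy, of x] yx by (simp add: algebra_simps)
qed

lemma K_nz: "K \<noteq> 0"
  using K_eq t_neq[of 1 2] c3_ge_2 D_ge_3 by auto

text \<open>With \<open>x\<close> on a geodesic from \<open>u\<close> to \<open>y\<close>, every
  vertex of \<open>closer x y\<close> and \<open>closer y x\<close> has a forced distance from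
  \<open>u\<close>.\<close>

lemma recurrence:
  assumes "a + 3 \<le> D"
  shows "c3 * (t (a + 1) - t (a + 2)) = K * (t a - t (a + 3))"
proof -
  obtain u y where "d u y = a + 3" using dist_attained assms by blast
  then obtain x where ux: "d u x = a" and xy: "d x y = 3" and uy: "d u y = a + 3"
    using d_split[of u y a 3] by metis
  then have yx: "d y x = 3" by (simp add: d_sym)
  have "d z u = a + 1" if "z \<in> closer x y" for z
    using that d_adj_le[of x z u] d_adj_le[of z x u] adj_sym[of x z] d_triangle[of u y z] ux uy xy d_sym
    by (auto simp: closer_iff)
  then have 1: "(\<Sum>z\<in>closer x y. t (d z u)) = c3 * t (a + 1)" by (simp add: card_closer_3[OF xy])
  have "d w u = a + 2" if "w \<in> closer y x" for w
    using that d_adj_le[of y w u] d_triangle[of w u x] ux uy yx d_sym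
    by (auto simp: closer_iff)
  then have 2: "(\<Sum>w\<in>closer y x. t (d w u)) = c3 * t (a + 2)" by (simp add: card_closer_3[OF yx])
  show ?thesis using balanced_closer[OF xy, of u] 1 2 ux uy d_sym by (simp add: algebra_simps)
qed

text \<open>The recurrence one step beyond the diameter: an edge inside the last shell plays the role
  of a step to distance \<open>D + 1\<close>.\<close>

lemma recurrence_end: "c3 * (t (D - 1) - t D) = K * (t (D - 2) - t D)"
proof -
  obtain u y y' where uy: "d u y = D" "d u y' = D" "adj y y'" using diam_edge .
  have "d u y' = (D - 2) + 2" using uy D_ge_3 by simp
  then obtain x where ux: "d u x = D - 2" and xy': "d x y' = 2" using d_split by blast
  have sy: "adj y' y" using uy adj_sym by blast
  have "d y x = 1 \<or> d y x = 3"
    using nbr_dist_lt[of y' x 1 y] sy xy' D_ge_3 d_sym by auto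
  moreover have "d y x \<noteq> 1" using d_triangle[of u y x] ux uy D_ge_3 d_sym[of x y] by auto
  ultimately have yx: "d y x = 3" by blast
  then have xy: "d x y = 3" by (simp add: d_sym)
  have D3: "d x u = Suc (D - 3)" "Suc (D - 3) < D" using ux D_ge_3 d_sym by auto
  have near: "d z u = D - 1" if "adj x z" "D - 2 \<le> d z u" for z
    using nbr_dist_lt[OF D3(1) that(1) D3(2)] that(2) D_ge_3 by auto
  have z: "d z u = D - 1" if "z \<in> closer x y" for z
    using that xy uy d_triangle[of u y z] d_sym[of z u] near by (auto simp: closer_iff)
  \<comment> \<open>Otherwise \<open>w\<close> and a common neighbour of \<open>w\<close> and
    \<open>x\<close> would be adjacent vertices at distance \<open>D - 1\<close> from
    \<open>u\<close>, against a_(D-1) = 0.\<close>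
  have w: "d w u = D" if wc: "w \<in> closer y x" for w
  proof (rule ccontr)
    assume wD: "d w u \<noteq> D"
    have "adj y w" "d w x = 1 + 1" using wc yx by (auto simp: closer_iff)
    have wu: "d w u = D - 1"
      using nbr_dist[of y u "D - 1" w] uy d_sym \<open>adj y w\<close> wD D_ge_3 by auto
    obtain v where v: "d w v = 1" "d v x = 1" using d_split[OF \<open>d w x = 1 + 1\<close>] by blast
    have "d v u = D - 1"
      using near[of v] v d_triangle[of w u v] wu d_eq_1_iff[of v x] adj_sym by auto
    moreover have "D - 1 = Suc (D - 2)" "Suc (D - 2) < D" using D_ge_3 by auto
    moreover have "adj v w" using v d_eq_1_iff adj_sym by blast
    ultimately show False using nbr_dist_lt[of v u "D - 2" w] wu by auto
  qed
  show ?thesis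
    using balanced_closer[OF xy, of u] z w ux uy d_sym
    by (simp add: card_closer_3[OF xy] card_closer_3[OF yx] algebra_simps)
qed

text \<open>The base vertex \<open>u\<close> is taken from \<open>closer x y\<close>. It contributes
  \<open>t 0\<close> and its common neighbour with \<open>y\<close> contributes \<open>t 1\<close>;
  the others lie at distance 2 on the side of \<open>x\<close> and 3 on the side of
  \<open>y\<close>.\<close>

lemma initial_relation: "(t 0 - t 1) + (real c3 - 1) * (t 2 - t 3) = K * (t 1 - t 2)"
proof -
  obtain x y where xy: "d x y = 3" using dist_attained[of 3] D_ge_3 by auto
  then have yx: "d y x = 3" by (simp add: d_sym)
  have "closer x y \<noteq> {}" using card_closer_3[OF xy] c3_ge_2 by auto
  then obtain u where u: "u \<in> closer x y" by blast
  then have xu: "adj x u" and uy: "d u y = 2" using xy by (auto simp: closer_iff)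
  obtain w where w: "adj u w" "adj w y" "closer u y = {w}" using closer_2[OF uy] .
  have wc: "w \<in> closer y x"
    using w yx d_triangle[of w x u] xu d_adj_le[of y w x] adj_sym by (auto simp: closer_iff adj_d)
  have "(\<Sum>z\<in>closer x y. t (d z u)) = t 0 + (\<Sum>z\<in>closer x y - {u}. t (d z u))"
    using u by (simp add: sum.remove)
  also have "(\<Sum>z\<in>closer x y - {u}. t (d z u)) = (\<Sum>z\<in>closer x y - {u}. t 2)"
    using nbrs_dist[OF _ xu] by (intro sum.cong refl) (auto simp: closer_iff)
  finally have 1: "(\<Sum>z\<in>closer x y. t (d z u)) = t 0 + (real c3 - 1) * t 2"
    using u card_closer_3[OF xy] c3_ge_2 by (simp add: of_nat_diff)
  have far: "d w' u = 3" if "w' \<in> closer y x - {w}" for w'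
  proof -
    have "adj y w'" using that by (auto simp: closer_iff)
    then have "d w' u = 1 \<or> d w' u = 3"
      using nbr_dist_lt[of y u 1 w'] uy d_sym D_ge_3 by auto
    moreover have "d w' u \<noteq> 1"
    proof
      assume "d w' u = 1"
      then have "w' \<in> closer u y"
        using \<open>adj y w'\<close> uy d_eq_1_iff[of u w'] d_eq_1_iff[of w' y] adj_sym d_sym by (auto simp: closer_iff)
      then show False using that w by auto
    qed
    ultimately show ?thesis by simp
  qed
  have "(\<Sum>w'\<in>closer y x. t (d w' u)) = t (d w u) + (\<Sum>w'\<in>closer y x - {w}. t (d w' u))"
    using wc by (simp add: sum.remove)
  also have "(\<Sum>w'\<in>closer y x - {w}. t (d w' u)) = (\<Sum>w'\<in>closer y x - {w}. t 3)"
    using far by (intro sum.cong refl) auto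
  also have "d w u = 1" using w d_eq_1_iff d_sym by metis
  finally have 2: "(\<Sum>w'\<in>closer y x. t (d w' u)) = t 1 + (real c3 - 1) * t 3"
    using wc card_closer_3[OF yx] c3_ge_2 by (simp add: of_nat_diff)
  have "d x u = 1" using xu d_eq_1_iff by simp
  then show ?thesis using balanced_closer[OF xy, of u] 1 2 uy d_sym[of y u] by (simp add: algebra_simps)
qed

text \<open>By the balanced set condition any two neighbours of \<open>z\<^sub>1\<close> have the same number of common
  blocks \<open>closer z\<^sub>1 w\<close>, which turns these blocks into a symmetric 2-design.\<close>

lemma design_divisibility: "(k - 2) dvd (c3 - 1) * (c3 - 2)"
proof -
  obtain x y where xy: "d x y = 3" using dist_attained[of 3] D_ge_3 by auto
  then have yx: "d y x = 3" by (simp add: d_sym)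
  have "closer x y \<noteq> {}" using card_closer_3[OF xy] c3_ge_2 by auto
  then obtain z1 where z1: "z1 \<in> closer x y" by blast
  then have xz1: "adj x z1" and z1y: "d z1 y = 2" using xy by (auto simp: closer_iff)
  obtain w1 where w1: "adj z1 w1" "adj w1 y" "closer z1 y = {w1}" using closer_2[OF z1y] .
  have w1x: "w1 \<in> closer y x"
    using w1 yx d_triangle[of w1 x z1] xz1 d_adj_le[of y w1 x] adj_sym by (auto simp: closer_iff adj_d)
  have "w1 \<noteq> x" using w1x yx by (auto simp: closer_iff)
  define Q where "Q = nbhd z1 - {x, w1}"
  have Q_card: "card Q = k - 2"
    using xz1 w1 adj_sym \<open>w1 \<noteq> x\<close> by (simp add: Q_def card_Diff_subset nbhd_iff card_nbhd)
  \<comment> \<open>Besides \<open>w1\<close>, this counts the blocks \<open>closer z1 w\<close>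
    through \<open>u\<close>. All of these also contain \<open>x\<close> and \<open>w1\<close>, so
    \<open>\<beta> u - 1\<close> is the lambda of the design.\<close>
  define \<beta> where "\<beta> u = card {w \<in> closer y x. d w u = 2}" for u
  \<comment> \<open>For \<open>D = 3\<close> the vertices that would lie at distance 4 stay at
    distance 3.\<close>
  let ?t4 = "t (min 4 D)"
  have \<beta>: "t 1 + (real c3 - 1) * t 3 - (\<beta> u * t 2 + (real c3 - \<beta> u) * ?t4) = K * (t 2 - t 3)"
    if u: "u \<in> Q" for u
  proof -
    have zu: "adj z1 u" "u \<noteq> x" "u \<noteq> w1" using u by (auto simp: Q_def nbhd_iff)
    have ux: "d x u = 2" using nbrs_dist[of z1 x u] xz1 adj_sym zu by auto
    have "d u y = 1 \<or> d u y = 3" using nbr_dist_lt[of z1 y 1 u] z1y zu D_ge_3 by auto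
    moreover have "d u y \<noteq> 1"
    proof
      assume "d u y = 1"
      then have "u \<in> closer z1 y" using zu z1y by (auto simp: closer_iff)
      then show False using w1 zu by auto
    qed
    ultimately have yu: "d y u = 3" using d_sym by metis
    have "d z u = 3" if "z \<in> closer x y - {z1}" for z
    proof -
      have "adj x z" using that by (auto simp: closer_iff)
      then have "d z u = 1 \<or> d z u = 3" using nbr_dist_lt[of x u 1 z] ux D_ge_3 by auto
      moreover have "d z u \<noteq> 1"
        using common_nbr_unique[of x z u z1] \<open>adj x z\<close> xz1 zu that d_eq_1_iff by auto
      ultimately show ?thesis by simp
    qed
    then have "(\<Sum>z\<in>closer x y - {z1}. t (d z u)) = (\<Sum>z\<in>closer x y - {z1}. t 3)"
      by (intro sum.cong refl) auto
    moreover have "(\<Sum>z\<in>closer x y. t (d z u)) = t (d z1 u) + (\<Sum>z\<in>closer x y - {z1}. t (d z u))"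
      using z1 by (simp add: sum.remove)
    moreover have "d z1 u = 1" using zu d_eq_1_iff by simp
    ultimately have 1: "(\<Sum>z\<in>closer x y. t (d z u)) = t 1 + (real c3 - 1) * t 3"
      using z1 card_closer_3[OF xy] c3_ge_2 by (simp add: of_nat_diff)
    let ?B = "{w \<in> closer y x. d w u = 2}"
    have far: "d w u = min 4 D" if "w \<in> closer y x - ?B" for w
      using nbr_dist[of y u 2 w] yu that by (auto simp: closer_iff eval_nat_numeral)
    have card_far: "real (card (closer y x - ?B)) = real c3 - \<beta> u"
    proof -
      have "card ?B \<le> card (closer y x)" by (intro card_mono) auto
      then show ?thesis by (subst card_Diff_subset) (auto simp: \<beta>_def card_closer_3[OF yx] of_nat_diff)
    qed
    have "(\<Sum>w\<in>closer y x. t (d w u)) = (\<Sum>w\<in>closer y x - ?B. t (d w u)) + (\<Sum>w\<in>?B. t (d w u))"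
      by (rule sum.subset_diff) auto
    also have "(\<Sum>w\<in>closer y x - ?B. t (d w u)) = (\<Sum>w\<in>closer y x - ?B. ?t4)"
      using far by (intro sum.cong refl) auto
    also have "(\<Sum>w\<in>?B. t (d w u)) = \<beta> u * t 2" by (simp add: \<beta>_def)
    finally have 2: "(\<Sum>w\<in>closer y x. t (d w u)) = \<beta> u * t 2 + (real c3 - \<beta> u) * ?t4"
      by (simp add: card_far)
    show ?thesis using balanced_closer[OF xy, of u] ux yu unfolding 1 2 by simp
  qed
  \<comment> \<open>Distinct dual eigenvalues make the linear equation for \<open>\<beta> u\<close>
    uniquely solvable.\<close>
  have t24: "t 2 \<noteq> ?t4" using t_neq[of 2 "min 4 D"] D_ge_3 by auto
  have \<beta>_const: "\<beta> u = \<beta> u'" if "u \<in> Q" "u' \<in> Q" for u u'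
  proof -
    have "(real (\<beta> u) - \<beta> u') * (t 2 - ?t4) = 0" using \<beta>[OF that(1)] \<beta>[OF that(2)] by (simp add: algebra_simps)
    then show ?thesis using t24 by simp
  qed
  have sum1: "(\<Sum>u\<in>Q. \<beta> u) = (\<Sum>w\<in>closer y x. card {u \<in> Q. d w u = 2})"
    unfolding \<beta>_def by (rule sum_multicount_gen) auto
  have c_w1: "card {u \<in> Q. d w1 u = 2} = k - 2"
  proof -
    have "{u \<in> Q. d w1 u = 2} = Q" using nbrs_dist[of z1 w1] w1 by (auto simp: Q_def nbhd_iff)
    then show ?thesis using Q_card by simp
  qed
  have c_w: "card {u \<in> Q. d w u = 2} = c3 - 2" if "w \<in> closer y x - {w1}" for w
  proof -
    have yw: "adj y w" and wx: "d w x = 2" using that yx by (auto simp: closer_iff)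
    have "d w z1 = 1 \<or> d w z1 = 3"
      using nbr_dist_lt[of y z1 1 w] z1y d_sym D_ge_3 yw by auto
    moreover have "d w z1 \<noteq> 1"
    proof
      assume "d w z1 = 1"
      then have "w \<in> closer z1 y" using yw z1y d_eq_1_iff[of w z1] adj_sym by (auto simp: closer_iff adj_d)
      then show False using w1 that by auto
    qed
    ultimately have z1w: "d z1 w = 3" using d_sym by metis
    have "{u \<in> Q. d w u = 2} = closer z1 w - {x, w1}"
      using z1w d_sym by (auto simp: Q_def closer_iff nbhd_iff)
    moreover have "x \<in> closer z1 w" using xz1 adj_sym wx z1w d_sym[of x w] by (auto simp: closer_iff)
    moreover have "w1 \<in> closer z1 w"
      using w1 yw nbrs_dist[of y w1 w] adj_sym that z1w by (auto simp: closer_iff)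
    ultimately show ?thesis using card_closer_3[OF z1w] \<open>w1 \<noteq> x\<close> by (simp add: card_Diff_subset)
  qed
  have "(\<Sum>w\<in>closer y x. card {u \<in> Q. d w u = 2}) = (k - 2) + (\<Sum>w\<in>closer y x - {w1}. card {u \<in> Q. d w u = 2})"
    using w1x c_w1 by (simp add: sum.remove)
  also have "(\<Sum>w\<in>closer y x - {w1}. card {u \<in> Q. d w u = 2}) = (\<Sum>w\<in>closer y x - {w1}. c3 - 2)"
    using c_w by (intro sum.cong refl) auto
  finally have sum2: "(\<Sum>u\<in>Q. \<beta> u) = (k - 2) + (c3 - 1) * (c3 - 2)"
    using sum1 w1x card_closer_3[OF yx] by simp
  have "Q \<noteq> {}" using Q_card k_ge_3 by auto
  then obtain u0 where "u0 \<in> Q" by blast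
  then have "(\<Sum>u\<in>Q. \<beta> u) = (\<Sum>u\<in>Q. \<beta> u0)" by (intro sum.cong refl \<beta>_const)
  then have "(k - 2) * \<beta> u0 = (k - 2) + (c3 - 1) * (c3 - 2)" using sum2 Q_card by simp
  then have "(k - 2) dvd (k - 2) + (c3 - 1) * (c3 - 2)" by (rule dvdI[OF sym])
  then show ?thesis using dvd_add_right_iff[of "k - 2" "k - 2"] by simp
qed

text \<open>The constant \<beta> + 1 of the three-term recurrence of the dual eigenvalues.\<close>

definition r :: real where "r = c3 / K"

lemma eigenvalue: "s = - (real k - 1)" and ratio: "r = -1"
proof -
  have r_mult: "r * a = b" if "real c3 * a = K * b" for a b :: real
    using that K_nz by (simp add: r_def field_simps)
  have km: "real (k - 1) = real k - 1" using k_ge_3 by (simp add: of_nat_diff)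
  have k1: "k - 1 + 1 = k" "k - 1 - 1 = k - 2" using k_ge_3 by auto
  have rec: "t a - t (a + 3) = r * (t (a + 1) - t (a + 2))" if "a + 3 \<le> D" for a
    using r_mult[OF recurrence[OF that]] by simp
  have recD: "t (D - 2) - t D = r * (t (D - 1) - t D)"
    using r_mult[OF recurrence_end] by simp
  have e4: "r * (t 0 - t 1 + (real c3 - 1) * (t 2 - t 3)) = c3 * (t 1 - t 2)"
    unfolding initial_relation using K_nz by (simp add: r_def)
  obtain n3 where n3: "n3 * c3 = k * (k - 1)\<^sup>2" "D \<ge> 4 \<Longrightarrow> \<exists>n4. n4 * p 4 1 3 = n3 * (k - c3)"
    using shell_counts by blast
  have div3: "c3 dvd (k - 1 + 1) * (k - 1)\<^sup>2" unfolding k1 using n3(1) by (metis dvd_triv_right)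
  have div4: "\<exists>(n :: nat) (c4 :: nat). real c4 * (t 3 - t 4) = (s - real (k - 1 + 1)) * t 4 \<and>
        n * c4 * c3 = (k - 1 + 1) * (k - 1)\<^sup>2 * (k - 1 + 1 - c3)" if "D = 4"
  proof -
    have "4 \<le> D" using that by simp
    then obtain n4 where n4: "n4 * p 4 1 3 = n3 * (k - c3)" using n3(2) by blast
    have "n4 * p 4 1 3 * c3 = k * (k - 1)\<^sup>2 * (k - c3)"
      unfolding n4 using n3(1) by (simp add: mult_ac)
    moreover have "p 4 1 3 * (t 3 - t 4) = (s - real k) * t 4"
      using eigen_step[of 3] that by (simp add: eval_nat_numeral algebra_simps)
    ultimately show ?thesis unfolding k1 by blast
  qed
  note ar = dual_eigenvalue_arithmetic[of D t r s "k - 1" c3, OF D_ge_3 t_inj rec recD _ _ _ e4 c3_ge_2 _ _ _ div4]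
  have "s = - real (k - 1) \<and> r = -1"
    using ar eigen_0 eigen_1 eigen_2 c3_lt_k design_divisibility div3 k1 km by simp
  then show "s = - (real k - 1)" "r = -1" using km by auto
qed

end

section \<open>Reconstruction of the Odd graph\<close>

text \<open>\<open>Lab x\<close> plays the role of the complement of the \<open>D\<close>-set \<open>x\<close>: the edge from \<open>x\<close> to \<open>y\<close> is
  labelled by the single point outside of \<open>x\<close> and \<open>y\<close>.\<close>

lemma odd_graph_from_labels:
  fixes Lab :: "'v::finite \<Rightarrow> 'l set"
  assumes L: "finite L" "card L = 2 * D + 1"
    and sub: "\<And>x. Lab x \<subseteq> L" and card_Lab: "\<And>x. card (Lab x) = D + 1"
    and cover: "\<And>x y. adj x y \<Longrightarrow> Lab x \<union> Lab y = L"
    and edge: "\<And>x l. l \<in> Lab x \<Longrightarrow> \<exists>y. adj x y \<and> Lab x \<inter> Lab y = {l}"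
    and inj: "inj Lab"
  shows "graph_isomorphic UNIV adj (odd_graph_verts D) odd_graph_adj"
proof -
  define F where "F x = L - Lab x" for x
  have fin: "finite (Lab x)" for x using sub L finite_subset by blast
  have F_card: "card (F x) = D" for x
    using card_Diff_subset[OF fin sub, of x] L card_Lab[of x] by (simp add: F_def)
  have F_sub: "F x \<subseteq> L" for x by (auto simp: F_def)
  have F_fin: "finite (F x)" for x using L by (simp add: F_def)
  have inj_F: "inj F"
    using inj sub unfolding F_def inj_def by (metis double_diff order_refl)
  have F_edge: "\<exists>y. adj x y \<and> F y = Lab x - {l}" if "l \<in> Lab x" for x l
  proof -
    obtain y where y: "adj x y" "Lab x \<inter> Lab y = {l}" using edge \<open>l \<in> Lab x\<close> by blast
    then have "F y = Lab x - {l}" using cover[OF y(1)] by (auto simp: F_def)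
    then show ?thesis using y by blast
  qed
  \<comment> \<open>Two steps along edges exchange one element of \<open>F x\<close> for an element
    of \<open>T\<close>, so repeated exchanges reach \<open>T\<close>.\<close>
  have surj: "\<exists>y. F y = T" if "card (T - F x) = n" "T \<subseteq> L" "card T = D" for T x n
    using that
  proof (induction n arbitrary: x)
    case 0
    have "finite T" using 0 L finite_subset by blast
    then have "T \<subseteq> F x" using 0 by auto
    then have "T = F x" using card_subset_eq[OF F_fin] F_card 0 by metis
    then show ?case by blast
  next
    case (Suc n)
    have fT: "finite T" using Suc L finite_subset by blast
    have "T - F x \<noteq> {}" using Suc.prems(1) by force
    then obtain b where b: "b \<in> T" "b \<notin> F x" by blast
    have "\<not> F x \<subseteq> T"
    proof
      assume "F x \<subseteq> T"
      then have "F x = T" using card_subset_eq[OF fT] F_card Suc.prems by metis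
      then show False using b by blast
    qed
    then obtain a where a: "a \<in> F x" "a \<notin> T" by blast
    have "b \<in> Lab x" using b Suc.prems by (auto simp: F_def)
    then obtain y where y: "adj x y" "F y = Lab x - {b}" using F_edge by blast
    have "a \<in> Lab y" using a y by (auto simp: F_def)
    then obtain z where z: "F z = Lab y - {a}" using F_edge by blast
    have "Lab y = L - F y" using sub[of y] by (auto simp: F_def)
    then have Fz: "F z = insert b (F x) - {a}"
      using y z \<open>b \<in> Lab x\<close> sub[of x] by (auto simp: F_def)
    have "T - F z = (T - F x) - {b}" using Fz a b by auto
    then have "card (T - F z) = n" using Suc.prems(1) b fT by simp
    then show ?case using Suc by blast
  qed
  have adj_iff: "adj x y \<longleftrightarrow> F x \<inter> F y = {}" for x y
  proof
    show "F x \<inter> F y = {}" if "adj x y" using cover[OF that] by (auto simp: F_def)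
    \<comment> \<open>\<open>F y\<close> is \<open>Lab x\<close> without one label, and some
      neighbour of \<open>x\<close> has the same set; injectivity identifies it with
      \<open>y\<close>.\<close>
    assume dis: "F x \<inter> F y = {}"
    then have s: "F y \<subseteq> Lab x" by (auto simp: F_def)
    then have "card (Lab x - F y) = 1" using card_Diff_subset[OF F_fin s] F_card card_Lab by simp
    then obtain l where l: "Lab x - F y = {l}" by (rule card_1_singletonE)
    then obtain z where z: "adj x z" "F z = Lab x - {l}" using F_edge by blast
    then have "F z = F y" using l s by auto
    then show "adj x y" using z inj_F by (metis injD)
  qed
  obtain h where h: "bij_betw h L {1..2 * D + 1}"
    using finite_same_card_bij[of L "{1..2 * D + 1}"] L by auto
  have h_inj: "inj_on h L" and h_img: "h ` L = {1..2 * D + 1}" using h by (auto simp: bij_betw_def)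
  define f where "f x = h ` F x" for x
  have f_inter: "f x \<inter> f y = {} \<longleftrightarrow> F x \<inter> F y = {}" for x y
    unfolding f_def inj_on_image_Int[OF h_inj F_sub F_sub, symmetric] by simp
  have "bij_betw f UNIV (odd_graph_verts D)"
    unfolding bij_betw_def
  proof
    show "inj f" unfolding f_def
      using inj_F inj_on_image_eq_iff[OF h_inj F_sub F_sub] by (simp add: inj_def)
    show "range f = odd_graph_verts D"
    proof
      show "range f \<subseteq> odd_graph_verts D"
      proof clarify
        fix x
        have "card (f x) = D" unfolding f_def
          using card_image[OF inj_on_subset[OF h_inj F_sub]] F_card by simp
        moreover have "f x \<subseteq> {1..2 * D + 1}" unfolding f_def h_img[symmetric] using F_sub by blast
        ultimately show "f x \<in> odd_graph_verts D" by (simp add: odd_graph_verts_def)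
      qed
      show "odd_graph_verts D \<subseteq> range f"
      proof
        fix S assume S: "S \<in> odd_graph_verts D"
        then have S': "S \<subseteq> h ` L" "card S = D" by (auto simp: odd_graph_verts_def h_img)
        then obtain T where T: "T \<subseteq> L" "S = h ` T" by (meson subset_image_iff)
        then have "card T = D" using card_image[OF inj_on_subset[OF h_inj T(1)]] S' by simp
        then obtain y where "F y = T" using surj[OF refl T(1)] by blast
        then show "S \<in> range f" using T by (auto simp: f_def)
      qed
    qed
  qed
  moreover have "\<forall>x\<in>UNIV. \<forall>y\<in>UNIV. adj x y \<longleftrightarrow> odd_graph_adj (f x) (f y)"
    using adj_iff f_inter by (simp add: odd_graph_adj_def)
  ultimately show ?thesis unfolding graph_isomorphic_def by blast
qed

text \<open>The squared norm of the sum of all vectors is |V| (n + 1 - |V|) e, which would otherwise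
  be negative.\<close>

lemma card_obtuse_vectors:
  fixes V :: "'a::real_inner set" and n :: nat and e :: real
  assumes "finite V" and e: "e > 0"
    and norm: "\<And>u. u \<in> V \<Longrightarrow> u \<bullet> u = n * e"
    and obtuse: "\<And>u w. u \<in> V \<Longrightarrow> w \<in> V \<Longrightarrow> u \<noteq> w \<Longrightarrow> u \<bullet> w = - e"
  shows "card V \<le> n + 1"
proof (rule ccontr)
  assume c: "\<not> card V \<le> n + 1"
  have "(\<Sum>w\<in>V. u \<bullet> w) = (real n + 1 - card V) * e" if u: "u \<in> V" for u
  proof -
    have "(\<Sum>w\<in>V. u \<bullet> w) = u \<bullet> u + (\<Sum>w\<in>V - {u}. u \<bullet> w)" using assms(1) u by (simp add: sum.remove)
    also have "(\<Sum>w\<in>V - {u}. u \<bullet> w) = (\<Sum>w\<in>V - {u}. - e)" using obtuse u by (intro sum.cong) auto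
    also have "\<dots> = - (real (card V) - 1) * e"
      using assms(1) u c by (simp add: of_nat_diff algebra_simps)
    finally show ?thesis using norm[OF u] by (simp add: algebra_simps)
  qed
  then have "(\<Sum>u\<in>V. u) \<bullet> (\<Sum>w\<in>V. w) = (\<Sum>u\<in>V. (real n + 1 - card V) * e)"
    unfolding inner_sum_left inner_sum_right by (subst sum.swap) (intro sum.cong, auto)
  also have "\<dots> = card V * ((real n + 1 - card V) * e)" by simp
  also have "\<dots> < 0"
  proof -
    have "real n + 1 - card V < 0" "0 < real (card V)" using c by auto
    then show ?thesis using e by (simp add: mult_less_0_iff)
  qed
  finally show False using inner_ge_zero[of "\<Sum>u\<in>V. u"] by simp
qed

lemma chebU_2: "chebU 2 n = real n + 1"
  by (induction n rule: induct_nat_012) auto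

section \<open>The simplex of edge labels\<close>

context dual_sequence
begin

text \<open>The scale at which edge labels have squared norm 2 D e and distinct labels have inner
  product -e.\<close>

definition e :: real where "e = (-1) ^ (D - 1) * (t (D - 1) - t D) / (2 * D + 1)"

lemma alternating_linear:
  assumes "n < D"
  shows "(-1) ^ n * (t n - t (Suc n)) = (2 * D + 1) * e * (real D - n)"
proof -
  have r_mult: "r * a = b" if "real c3 * a = K * b" for a b :: real
    using that K_nz by (simp add: r_def field_simps)
  have rec: "t a - t (a + 3) = r * (t (a + 1) - t (a + 2))" if "a + 3 \<le> D" for a
    using r_mult[OF recurrence[OF that]] by simp
  have recD: "t (D - 2) - t D = r * (t (D - 1) - t D)"
    using r_mult[OF recurrence_end] by simp
  have "(-1) ^ n * (t n - t (Suc n)) =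
      (-1) ^ (D - 1) * (t (D - 1) - t (Suc (D - 1))) * chebU (1 - r) (D - 1 - n)"
    by (rule alternating_differences[OF _ rec recD assms]) (use D_ge_3 in auto)
  moreover have "1 - r = 2" using ratio by simp
  moreover have "chebU 2 (D - 1 - n) = real D - n" using assms by (simp add: chebU_2 of_nat_diff)
  ultimately show ?thesis using D_ge_3 by (simp add: e_def)
qed

text \<open>The first two differences are in the ratio D to -(D - 1), and the eigenvalue equation
  turns this into (k - 2) D = (k - 1)(D - 1).\<close>

lemma k_eq: "k = D + 1"
proof -
  have 0: "t 0 - t 1 = (2 * D + 1) * e * D" and 1: "t 1 - t 2 = - ((2 * D + 1) * e * (real D - 1))"
    using alternating_linear[of 0] alternating_linear[of 1] D_ge_3 by (auto simp: numeral_2_eq_2)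
  have "(s + 1) * (t 0 - t 1) = (real k - 1) * (t 1 - t 2)"
    using eigen_0 eigen_1 by (simp add: algebra_simps)
  then have "(2 * D + 1) * e * ((real k - 2) * D) = (2 * D + 1) * e * ((real k - 1) * (real D - 1))"
    unfolding 0 1 eigenvalue by (simp add: algebra_simps)
  moreover have "(2 * D + 1) * e \<noteq> 0" using 0 t_neq[of 0 1] D_ge_3 by auto
  ultimately have "(real k - 2) * D = (real k - 1) * (real D - 1)" by simp
  then have "real k = real (D + 1)" by (simp add: algebra_simps)
  then show ?thesis by (simp only: of_nat_eq_iff)
qed

lemma t_0_eq: "t 0 = D * (D + 1) * e"
proof -
  have "t 0 - t 1 = (2 * D + 1) * e * D" using alternating_linear[of 0] D_ge_3 by simp
  moreover have "- D * t 0 = (D + 1) * t 1" using eigen_0 eigenvalue k_eq by simp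
  ultimately have "(2 * D + 1) * t 0 = (2 * D + 1) * (D * (D + 1) * e)" by (simp add: algebra_simps)
  then show ?thesis by simp
qed

lemma e_pos: "0 < e"
proof (rule ccontr)
  assume "\<not> 0 < e"
  then have "real (D * (D + 1)) * e \<le> 0" by (intro mult_nonneg_nonpos) auto
  then show False using t_0_pos t_0_eq by simp
qed

text \<open>The inner product of an edge label with the vector of a vertex whose smaller distance to
  the edge is i; the minimum covers edges inside the last shell.\<close>

definition pair_val :: "nat \<Rightarrow> real" where "pair_val i = t i + t (min (Suc i) D)"

text \<open>The alternating differences of \<open>t\<close> decrease linearly to 0 at
  \<open>D\<close>, so those of \<open>pair_val\<close> are constant and it oscillates between two
  values.\<close>

lemma pair_val_eq:
  "i \<le> D \<Longrightarrow> pair_val i = (if even i then D * e else - (D + 1) * e)"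
proof (induction i)
  case 0
  have "t 0 - t 1 = (2 * D + 1) * e * D" using alternating_linear[of 0] D_ge_3 by simp
  then have "t 0 + t 1 = D * e" using t_0_eq by (simp add: algebra_simps)
  then show ?case using D_ge_3 by (simp add: pair_val_def)
next
  case (Suc i)
  have 1: "(-1) ^ i * (t i - t (Suc i)) = (2 * D + 1) * e * (real D - i)"
    using alternating_linear[of i] Suc by simp
  have 2: "(-1) ^ i * (t (Suc i) - t (min (Suc (Suc i)) D)) = - ((2 * D + 1) * e * (real D - i - 1))"
  proof (cases "Suc i = D")
    case True
    then have "real D = real i + 1" by simp
    then show ?thesis using True by simp
  next
    case False
    then have "Suc i < D" using Suc by simp
    then show ?thesis using alternating_linear[of "Suc i"] by (simp add: min_def algebra_simps)
  qed
  have "pair_val i - pair_val (Suc i) = (t i - t (Suc i)) + (t (Suc i) - t (min (Suc (Suc i)) D))"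
    using Suc by (simp add: pair_val_def min_def)
  then have "(-1) ^ i * (pair_val i - pair_val (Suc i)) = (-1) ^ i * (t i - t (Suc i)) +
      (-1) ^ i * (t (Suc i) - t (min (Suc (Suc i)) D))"
    by (simp only: distrib_left)
  also have "\<dots> = (2 * D + 1) * e" unfolding 1 2 by (simp add: algebra_simps)
  finally have "(-1) ^ i * (pair_val i - pair_val (Suc i)) = (2 * D + 1) * e" .
  moreover have "pair_val i = (if even i then D * e else - (D + 1) * e)" using Suc by simp
  ultimately show ?case by (cases "even i") (auto simp: algebra_simps)
qed

lemma pair_sum:
  assumes "adj x y"
  shows "t (d x z) + t (d y z) = D * e \<or> t (d x z) + t (d y z) = - (D + 1) * e"
proof -
  obtain i where "i \<le> D" "t (d x z) + t (d y z) = pair_val i"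
  proof (cases "d x z")
    case 0
    then show thesis using that[of 0] adj_d[OF assms] D_ge_3 by (auto simp: pair_val_def min_def)
  next
    case (Suc i)
    then have "Suc i \<le> D" using d_le_diam[of x z] by simp
    then show thesis
      using nbr_dist[OF Suc assms] that[of i] that[of "Suc i"] Suc by (auto simp: pair_val_def min_def)
  qed
  then show ?thesis using pair_val_eq by auto
qed

definition vec_of :: "'v \<Rightarrow> real^'v" where "vec_of x = (\<chi> z. t (d x z))"

lemma inner_vec_of: "vec_of x \<bullet> vec_of y = t (d x y)"
  using t_gram[of x y] by (simp add: vec_of_def inner_vec_def d_sym[of y])

text \<open>In the Odd graph two disjoint D-sets miss exactly one point, and this vector depends
  only on that point.\<close>

definition lab :: "'v \<Rightarrow> 'v \<Rightarrow> real^'v" where "lab x y = vec_of x + vec_of y"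

lemma lab_sym: "lab x y = lab y x"
  by (simp add: lab_def add.commute)

lemma inner_lab: "lab x y \<bullet> lab z w = (t (d x z) + t (d y z)) + (t (d x w) + t (d y w))"
  by (simp add: lab_def inner_add_left inner_add_right inner_vec_of)

lemma norm_lab: assumes "adj x y" shows "lab x y \<bullet> lab x y = real (2 * D) * e"
proof -
  have "t 0 + t 1 = D * e" using pair_val_eq[of 0] D_ge_3 by (simp add: pair_val_def)
  moreover have "lab x y \<bullet> lab x y = 2 * (t 0 + t 1)" using assms by (simp add: inner_lab adj_d)
  ultimately show ?thesis by simp
qed

text \<open>The inner product is a sum of two values of \<open>pair_val\<close>: 2 D e, -e or -2 (D
  + 1) e. The last contradicts the Cauchy-Schwarz inequality, and the first is the squared norm, so
  it forces equality.\<close>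

lemma inner_lab_cases:
  assumes "adj x y" "adj z w"
  shows "lab x y = lab z w \<or> lab x y \<bullet> lab z w = - e"
proof -
  have n: "lab x y \<bullet> lab x y = real (2 * D) * e" "lab z w \<bullet> lab z w = real (2 * D) * e"
    using assms norm_lab by auto
  have "lab x y \<bullet> lab z w \<noteq> - 2 * (D + 1) * e"
  proof
    assume a: "lab x y \<bullet> lab z w = - 2 * (D + 1) * e"
    have "(lab x y + lab z w) \<bullet> (lab x y + lab z w) = - 4 * e"
      using n a by (simp add: inner_add_left inner_add_right inner_commute algebra_simps)
    then show False using inner_ge_zero[of "lab x y + lab z w"] e_pos by linarith
  qed
  then consider "lab x y \<bullet> lab z w = - e" | "lab x y \<bullet> lab z w = 2 * D * e"
    using pair_sum[OF assms(1), of z] pair_sum[OF assms(1), of w] unfolding inner_lab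
    by (auto simp: algebra_simps)
  then show ?thesis
  proof cases
    case 2
    then have "(lab x y - lab z w) \<bullet> (lab x y - lab z w) = 0"
      using n by (simp add: inner_diff_left inner_diff_right inner_commute)
    then show ?thesis by simp
  qed simp
qed

lemma inj_vec_of: "inj vec_of"
proof (rule injI)
  fix x y assume "vec_of x = vec_of y"
  then have "t 0 = t (d x y)" using inner_vec_of[of x x] inner_vec_of[of x y] by simp
  then show "x = y" using t_neq[of 0 "d x y"] d_le_diam[of x y] by auto
qed

definition Lab :: "'v \<Rightarrow> (real^'v) set" where "Lab x = lab x ` nbhd x"

definition labels :: "(real^'v) set" where "labels = (\<Union>x. Lab x)"

lemma card_Lab: "card (Lab x) = D + 1"
proof -
  have "inj_on (lab x) (nbhd x)" using inj_vec_of by (auto simp: lab_def inj_on_def)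
  then show ?thesis by (simp add: Lab_def card_image card_nbhd k_eq)
qed

text \<open>A second common label would come from edges to \<open>z\<close> and \<open>w\<close>
  with \<open>z\<close> and \<open>w\<close> at distance 3. The inner product of their labels is -e,
  not the squared norm.\<close>

lemma Lab_inter:
  assumes "adj x y" shows "Lab x \<inter> Lab y = {lab x y}"
proof
  show "{lab x y} \<subseteq> Lab x \<inter> Lab y"
    using assms adj_sym lab_sym by (auto simp: Lab_def nbhd_iff)
  show "Lab x \<inter> Lab y \<subseteq> {lab x y}"
  proof
    fix l assume "l \<in> Lab x \<inter> Lab y"
    then obtain z w where zw: "adj x z" "adj y w" "l = lab x z" "l = lab y w"
      by (auto simp: Lab_def nbhd_iff)
    show "l \<in> {lab x y}"
    proof (rule ccontr)
      assume n: "l \<notin> {lab x y}"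
      then have "z \<noteq> y" "w \<noteq> x" using zw lab_sym by auto
      have zy: "d z y = 2" and xw: "d x w = 2"
        using nbrs_dist[of x z y] nbrs_dist[of y x w] zw assms adj_sym \<open>z \<noteq> y\<close> \<open>w \<noteq> x\<close> by auto
      have "d z w = 3"
      proof -
        have "d w z = 1 \<or> d w z = 3"
          using nbr_dist_lt[of y z 1 w] zy zw d_sym D_ge_3 by auto
        moreover have "d w z \<noteq> 1"
        proof
          assume "d w z = 1"
          then have "adj z w" using d_eq_1_iff adj_sym by blast
          then have "x = w" using common_nbr_unique[of z x y w] zw assms adj_sym \<open>z \<noteq> y\<close> by blast
          then show False using \<open>w \<noteq> x\<close> by simp
        qed
        ultimately show ?thesis using d_sym by metis
      qed
      moreover have "d x y = 1" using assms d_eq_1_iff by simp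
      ultimately have "lab x z \<bullet> lab y w = pair_val 1 + pair_val 2"
        using zy xw D_ge_3 by (simp add: inner_lab pair_val_def eval_nat_numeral)
      moreover have "pair_val 1 + pair_val 2 = - e"
        using pair_val_eq[of 1] pair_val_eq[of 2] D_ge_3 by (simp add: algebra_simps)
      moreover have "lab x z \<bullet> lab y w = real (2 * D) * e" using norm_lab[OF zw(1)] zw by simp
      ultimately have "real (2 * D) * e = - e" by simp
      moreover have "real (2 * D) * e > 0" using e_pos D_ge_3 by simp
      ultimately show False using e_pos by linarith
    qed
  qed
qed

lemma card_labels_le: "card labels \<le> 2 * D + 1"
proof (rule card_obtuse_vectors[OF _ e_pos])
  show "finite labels" by (simp add: labels_def Lab_def)
  show "u \<bullet> u = real (2 * D) * e" if "u \<in> labels" for u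
    using that norm_lab by (auto simp: labels_def Lab_def nbhd_iff)
  show "u \<bullet> w = - e" if "u \<in> labels" "w \<in> labels" "u \<noteq> w" for u w
    using that inner_lab_cases by (fastforce simp: labels_def Lab_def nbhd_iff)
qed

text \<open>A single edge already supplies 2 (D + 1) - 1 labels, which is the upper bound for all of
  them.\<close>

lemma Lab_cover:
  assumes "adj x y" shows "Lab x \<union> Lab y = labels" and "card labels = 2 * D + 1"
proof -
  have "card (Lab x) + card (Lab y) = card (Lab x \<union> Lab y) + card (Lab x \<inter> Lab y)"
    by (rule card_Un_Int) (simp_all add: Lab_def)
  then have c: "card (Lab x \<union> Lab y) = 2 * D + 1" by (simp add: card_Lab Lab_inter[OF assms])
  have f: "finite labels" by (simp add: labels_def Lab_def)
  have s: "Lab x \<union> Lab y \<subseteq> labels" by (auto simp: labels_def)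
  have "card (Lab x \<union> Lab y) \<le> card labels" by (rule card_mono[OF f s])
  then show cl: "card labels = 2 * D + 1" using c card_labels_le by simp
  show "Lab x \<union> Lab y = labels" by (rule card_subset_eq[OF f s]) (simp add: c cl)
qed

text \<open>The sum is (k + s) times the vector of \<open>x\<close>, and k + s = 1. Thus the labels
  at a vertex determine it.\<close>

lemma sum_Lab: "(\<Sum>l\<in>Lab x. l) = vec_of x"
proof -
  have i: "inj_on (lab x) (nbhd x)" using inj_vec_of by (auto simp: lab_def inj_on_def)
  have "(\<Sum>l\<in>Lab x. l) = (\<Sum>y\<in>nbhd x. lab x y)" unfolding Lab_def by (simp add: sum.reindex[OF i])
  also have "\<dots> = vec_of x"
  proof (subst vec_eq_iff, rule allI)
    fix u
    have "(\<Sum>y\<in>nbhd x. lab x y) $ u = real k * t (d x u) + (\<Sum>y\<in>nbhd x. t (d y u))"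
      unfolding sum_component lab_def vec_of_def by (simp add: sum.distrib card_nbhd)
    also have "\<dots> = t (d x u)" unfolding eigen eigenvalue by (simp add: algebra_simps)
    finally show "(\<Sum>y\<in>nbhd x. lab x y) $ u = vec_of x $ u" by (simp add: vec_of_def)
  qed
  finally show ?thesis .
qed

lemma is_odd_graph: "graph_isomorphic UNIV adj (odd_graph_verts D) odd_graph_adj"
proof (rule odd_graph_from_labels[where Lab = Lab and L = labels])
  show "finite labels" by (simp add: labels_def Lab_def)
  obtain x y where "d x y = 1" using dist_attained[of 1] D_ge_3 by auto
  then show "card labels = 2 * D + 1" using Lab_cover(2) d_eq_1_iff by blast
  show "Lab x \<subseteq> labels" for x by (auto simp: labels_def)
  show "card (Lab x) = D + 1" for x by (rule card_Lab)
  show "Lab x \<union> Lab y = labels" if "adj x y" for x y using Lab_cover(1)[OF that] .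
  show "\<exists>y. adj x y \<and> Lab x \<inter> Lab y = {l}" if "l \<in> Lab x" for x l
  proof -
    from that obtain y where "adj x y" "l = lab x y" by (auto simp: Lab_def nbhd_iff)
    then show ?thesis using Lab_inter by blast
  qed
  show "inj Lab" by (rule injI) (metis sum_Lab inj_vec_of injD)
qed

end

theorem theorem4p1:
  fixes adj :: "'v::finite \<Rightarrow> 'v \<Rightarrow> bool" and D k :: nat
  assumes "distance_regular adj"
    and "diam adj = D" and "D \<ge> 3"
    and "has_valency adj k" and "k \<ge> 3"
    and "girth adj = 6"
    and "almost_bipartite adj"
    and "Q_polynomial adj"
  shows "graph_isomorphic UNIV adj (odd_graph_verts D) odd_graph_adj"
proof -
  obtain E q where Eq: "bij_betw E {..diam adj} (primitive_idempotents (bose_mesner adj))"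
    "E 0 = (1 / real CARD('v)) *\<^sub>R (\<chi> x y. 1)" "krein_parameters E (diam adj) q"
    "\<And>i j. i \<le> diam adj \<Longrightarrow> j \<le> diam adj \<Longrightarrow> i \<noteq> j \<Longrightarrow> q 1 i j \<noteq> 0 \<longleftrightarrow> \<bar>int i - int j\<bar> = 1"
    using assms(8) unfolding Q_polynomial_def by blast
  interpret qpoly_drg adj E q
    by unfold_locales (use assms Eq in auto)
  obtain s where s: "\<And>x y. (\<Sum>z\<in>nbhd x. t (d z y)) = s * t (d x y)" using t_eigenvector by blast
  obtain K where K: "\<And>x y u. d x y = 3 \<Longrightarrow>
     (\<Sum>z\<in>sphere_meet adj 1 2 x y. t (d z u)) - (\<Sum>z\<in>sphere_meet adj 2 1 x y. t (d z u))
       = K * (t (d x u) - t (d y u))" using balanced_set by blast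
  interpret dual_sequence adj k t s K
    by unfold_locales (use assms s K t_inj t_idem t_0_pos in auto)
  show ?thesis using is_odd_graph assms(2) by simp
qed

end
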